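(* There exists a positive constant $C$ such that for infinitely many positive integers $n$ one has $\omega(n-k) \le \Omega(n-k) \le C\log k$ for every integer $k$ with $1<k<n$.
   Context: $\omega(m)$ is the number of distinct prime factors of $m$, and $\Omega(m)$ is the number of prime factors of $m$ counted with multiplicity. *)

theory Defs
  imports Complex_Main "HOL-Computational_Algebra.Primes"
begin

definition omega :: "nat \<Rightarrow> nat" where
  "omega m = card (prime_factors m)"

definition Omega :: "nat \<Rightarrow> nat" where
  "Omega m = size (prime_factorization m)"

end

theory Submission
  imports Defs "HOL-Library.FuncSet" "HOL-Library.Infinite_Set" "HOL-Number_Theory.Cong"
begin

text \<open>
  Let \<open>n\<close> run over the multiples, up to \<open>X\<^sup>2\<close>, of a large factorial squared, so that for small \<open>k\<close> the small primes
  occur in \<open>n - k\<close> only as they do in \<open>k\<close>. A Brun--Hooley sieve whose dimension varies with the prime removes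
  the \<open>n\<close> for which some \<open>n - k\<close> has a medium prime factor below roughly \<open>X\<^bsup>1/k^2\<^esup>\<close>. Only
  about \<open>(log X / log p)\<^bsup>1/2\<^esup>\<close> values of \<open>k\<close> are sieved by \<open>p\<close>, which keeps the level bounded by a small
  power of \<open>X\<close>. Among the survivors, \<open>n - k\<close> has \<open>O(log k)\<close> prime factors above
  \<open>X\<^bsup>1/(c log k)\<^esup>\<close> for trivial reasons. More than \<open>O(log k)\<close> prime factors in the remaining range would give
  a divisor \<open>e \<le> X\<^bsup>1/10\<^esup>\<close> of \<open>n - k\<close> consisting of \<open>O(log k)\<close> such primes; as the reciprocals of these
  primes sum to \<open>O(log k)\<close>, Rankin's trick and the upper bound sieve show that the proportion of survivors
  with such a divisor is at most \<open>k\<^bsup>-6\<^esup>\<close>, and the union bound over \<open>k\<close> leaves a positive proportion.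
  For \<open>k > X\<^bsup>1/10\<^esup>\<close> the bound is trivial.
\<close>

text \<open>The obstacle is small \<open>k\<close>: a typical integer near \<open>n\<close> has
  about log log \<open>n\<close> prime factors, far more than C log \<open>k\<close>. Here log log
  \<open>X\<close> has order \<open>H\<close>. Hence for \<open>k > 2 ^ H\<close> the reciprocals of
  all primes up to \<open>X\<close> already sum to O(\<open>H\<close>) = O(log \<open>k\<close>),
  and no prime need be sieved out. For \<open>k\<close> near \<open>2 ^ i\<close> with
  \<open>i \<le> H\<close>, the primes between X^(1/4^i) and \<open>X\<close> have reciprocal sum
  O(\<open>i\<close>), so excluding only the primes below that range suffices.

  The bases 4 and 2 are matched: block \<open>j\<close> has primes of logarithmic size 4^(-j)
  relative to \<open>X\<close> and about 2^j classes for each prime, so its sieve depth is of order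
  2^j. It contributes about 2^j * 4^(-j) to the exponent of the level, and this series converges.

  The density \<open>V\<close> of survivors tends to 0, so the exceptional sets must be small
  relative to the survivors, not merely small. This works because the lower bound for the survivors
  and the upper bound for the survivors in a residue class modulo \<open>e\<close> contain the same
  factor \<open>V\<close>, which cancels in the union bound.\<close>

section \<open>Truncated inclusion-exclusion\<close>

text \<open>The combination of the elementary symmetric polynomials in \<open>x\<close> with
  coefficients \<open>c i\<close>. A free coefficient sequence lets one recursion serve truncated
  alternating sums, single degrees and their majorants.\<close>

definition sympoly :: "(nat \<Rightarrow> real) \<Rightarrow> ('a \<Rightarrow> real) \<Rightarrow> 'a set \<Rightarrow> real" where
  "sympoly c x P = (\<Sum>S\<in>Pow P. c (card S) * (\<Prod>p\<in>S. x p))"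

definition alt_upto :: "nat \<Rightarrow> nat \<Rightarrow> real" where
  "alt_upto r i = (if i \<le> r then (-1) ^ i else 0)"

definition only_at :: "nat \<Rightarrow> nat \<Rightarrow> real" where
  "only_at r i = (if i = r then 1 else 0)"

definition ones_upto :: "nat \<Rightarrow> nat \<Rightarrow> real" where
  "ones_upto r i = (if i \<le> r then 1 else 0)"

lemma sympoly_empty [simp]: "sympoly c x {} = c 0"
  by (simp add: sympoly_def)

text \<open>Splitting off one variable shifts the coefficient sequence. Together with
  \<open>coeff_shift\<close> this drives the later inductions on \<open>P\<close>.\<close>

lemma sympoly_insert:
  assumes "finite P" "p \<notin> P"
  shows "sympoly c x (insert p P) = sympoly c x P + x p * sympoly (\<lambda>i. c (Suc i)) x P"
proof -
  have fin: "finite S" if "S \<subseteq> P" for S using that assms finite_subset by blast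
  have inj: "inj_on (insert p) (Pow P)" using assms(2) by (auto simp: inj_on_def)
  have "sympoly c x (insert p P) = sympoly c x P + (\<Sum>S\<in>insert p ` Pow P. c (card S) * (\<Prod>p\<in>S. x p))"
    unfolding sympoly_def Pow_insert using assms by (intro sum.union_disjoint) auto
  also have "(\<Sum>S\<in>insert p ` Pow P. c (card S) * (\<Prod>p\<in>S. x p))
      = (\<Sum>S\<in>Pow P. c (card (insert p S)) * (\<Prod>p\<in>insert p S. x p))"
    using sum.reindex[OF inj] by simp
  also have "\<dots> = (\<Sum>S\<in>Pow P. x p * (c (Suc (card S)) * (\<Prod>p\<in>S. x p)))"
  proof (rule sum.cong[OF refl])
    fix S assume "S \<in> Pow P"
    then have "finite S" "p \<notin> S" using fin assms(2) by auto
    then show "c (card (insert p S)) * (\<Prod>p\<in>insert p S. x p) = x p * (c (Suc (card S)) * (\<Prod>p\<in>S. x p))"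
      by simp
  qed
  also have "\<dots> = x p * sympoly (\<lambda>i. c (Suc i)) x P"
    by (simp add: sympoly_def sum_distrib_left)
  finally show ?thesis .
qed

lemma sympoly_0: "sympoly (\<lambda>i. 0) x P = 0"
  by (simp add: sympoly_def)

lemma sympoly_uminus: "sympoly (\<lambda>i. - c i) x P = - sympoly c x P"
  by (simp add: sympoly_def sum_negf)

lemma sympoly_nonneg:
  assumes "\<And>i. c i \<ge> 0" "\<And>p. p \<in> P \<Longrightarrow> x p \<ge> 0"
  shows "sympoly c x P \<ge> 0"
  unfolding sympoly_def using assms by (intro sum_nonneg mult_nonneg_nonneg prod_nonneg) auto

lemma sympoly_mono:
  assumes "\<And>i. c i \<le> d i" "\<And>p. p \<in> P \<Longrightarrow> x p \<ge> 0"
  shows "sympoly c x P \<le> sympoly d x P"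
  unfolding sympoly_def using assms by (intro sum_mono mult_right_mono prod_nonneg) auto

lemma sympoly_mono_set:
  assumes "finite P" "Q \<subseteq> P" "\<And>i. c i \<ge> 0" "\<And>p. p \<in> P \<Longrightarrow> x p \<ge> 0"
  shows "sympoly c x Q \<le> sympoly c x P"
  unfolding sympoly_def using assms
  by (intro sum_mono2 mult_nonneg_nonneg prod_nonneg) auto

lemma coeff_shift:
  "(\<lambda>i. alt_upto (Suc r) (Suc i)) = (\<lambda>i. - alt_upto r i)"
  "(\<lambda>i. alt_upto 0 (Suc i)) = (\<lambda>i. 0)"
  "(\<lambda>i. only_at (Suc r) (Suc i)) = only_at r"
  "(\<lambda>i. only_at 0 (Suc i)) = (\<lambda>i. 0)"
  "(\<lambda>i. ones_upto (Suc r) (Suc i)) = ones_upto r"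
  "(\<lambda>i. ones_upto 0 (Suc i)) = (\<lambda>i. 0)"
  by (auto simp: alt_upto_def only_at_def ones_upto_def)

lemma only_at_nonneg: "only_at r i \<ge> 0"
  by (simp add: only_at_def)

lemma abs_coeff_le: "\<bar>alt_upto r i\<bar> \<le> ones_upto (Suc r) i" "\<bar>only_at (Suc r) i\<bar> \<le> ones_upto (Suc r) i"
  by (auto simp: alt_upto_def only_at_def ones_upto_def)

lemma sympoly_degree_0:
  assumes "finite P"
  shows "sympoly (alt_upto 0) x P = 1" "sympoly (only_at 0) x P = 1" "sympoly (ones_upto 0) x P = 1"
  using assms
  by (induction P rule: finite_induct)
    (simp_all add: sympoly_insert coeff_shift sympoly_0, simp_all add: alt_upto_def only_at_def ones_upto_def)

text \<open>The signed truncation error at degree \<open>r + 1\<close> gains \<open>x p\<close>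
  times the error at degree \<open>r\<close> when \<open>p\<close> is inserted, and the elementary
  symmetric polynomial of the next degree obeys the same recursion, so both bounds are inherited.
  Real \<open>x p\<close> in [0,1] cover indicators and densities alike.\<close>

lemma bonferroni:
  assumes "finite P" "\<And>p. p \<in> P \<Longrightarrow> 0 \<le> x p \<and> x p \<le> 1"
  shows "0 \<le> (-1) ^ r * (sympoly (alt_upto r) x P - (\<Prod>p\<in>P. 1 - x p)) \<and>
         (-1) ^ r * (sympoly (alt_upto r) x P - (\<Prod>p\<in>P. 1 - x p)) \<le> sympoly (only_at (Suc r)) x P"
  using assms
proof (induction P arbitrary: r rule: finite_induct)
  case empty
  then show ?case by (simp add: alt_upto_def only_at_def)
next
  case (insert p P)
  let ?D = "\<lambda>r. (-1) ^ r * (sympoly (alt_upto r) x P - (\<Prod>p\<in>P. 1 - x p))"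
  let ?V = "\<Prod>p\<in>P. 1 - x p"
  have IH: "0 \<le> ?D r \<and> ?D r \<le> sympoly (only_at (Suc r)) x P" for r
    using insert.IH insert.prems by blast
  have xp: "0 \<le> x p" "x p \<le> 1" using insert.prems by auto
  show ?case
  proof (cases r)
    case 0
    have V: "0 \<le> ?V" "?V \<le> 1" using insert.prems by (auto intro!: prod_nonneg prod_le_1)
    have "(-1) ^ r * (sympoly (alt_upto r) x (insert p P) - (\<Prod>p\<in>insert p P. 1 - x p)) = ?D 0 + x p * ?V"
      using insert.hyps 0 by (simp add: sympoly_insert coeff_shift sympoly_0 algebra_simps)
    moreover have "sympoly (only_at (Suc r)) x (insert p P) = sympoly (only_at (Suc 0)) x P + x p * 1"
      using insert.hyps 0 by (simp add: sympoly_insert coeff_shift sympoly_degree_0)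
    moreover have "0 \<le> x p * ?V" "x p * ?V \<le> x p * 1" using xp V mult_left_mono[of ?V 1 "x p"] by auto
    ultimately show ?thesis using IH[of 0] by linarith
  next
    case (Suc s)
    have "(-1) ^ r * (sympoly (alt_upto r) x (insert p P) - (\<Prod>p\<in>insert p P. 1 - x p)) = ?D (Suc s) + x p * ?D s"
      using insert.hyps Suc by (simp add: sympoly_insert coeff_shift sympoly_uminus algebra_simps)
    moreover have "sympoly (only_at (Suc r)) x (insert p P) = sympoly (only_at (Suc (Suc s))) x P + x p * sympoly (only_at (Suc s)) x P"
      using insert.hyps Suc by (simp add: sympoly_insert coeff_shift)
    moreover have "0 \<le> x p * ?D s" "x p * ?D s \<le> x p * sympoly (only_at (Suc s)) x P"
      using xp IH[of s] by (auto intro: mult_left_mono)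
    ultimately show ?thesis using IH[of "Suc s"] by linarith
  qed
qed

lemma bonferroni_even:
  assumes "finite P" "\<And>p. p \<in> P \<Longrightarrow> 0 \<le> x p \<and> x p \<le> 1" "even r"
  shows "(\<Prod>p\<in>P. 1 - x p) \<le> sympoly (alt_upto r) x P"
    and "sympoly (alt_upto r) x P \<le> (\<Prod>p\<in>P. 1 - x p) + sympoly (only_at (Suc r)) x P"
  using bonferroni[of P x r] assms by auto

lemma power_Suc_add_le:
  fixes s y :: real
  assumes "0 \<le> s" "0 \<le> y"
  shows "s ^ Suc r + real (Suc r) * y * s ^ r \<le> (s + y) ^ Suc r"
proof (induction r)
  case 0 then show ?case by simp
next
  case (Suc r)
  have "s ^ Suc (Suc r) + real (Suc (Suc r)) * y * s ^ Suc r
      \<le> (s + y) * (s ^ Suc r + real (Suc r) * y * s ^ r)"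
  proof -
    have "(s + y) * (s ^ Suc r + real (Suc r) * y * s ^ r)
        = s ^ Suc (Suc r) + real (Suc (Suc r)) * y * s ^ Suc r + real (Suc r) * (y * y) * s ^ r"
      by (simp add: algebra_simps)
    then show ?thesis using assms by simp
  qed
  also have "\<dots> \<le> (s + y) * (s + y) ^ Suc r"
    using Suc assms by (intro mult_left_mono) auto
  finally show ?case by simp
qed

text \<open>In the expansion of the \<open>r\<close>-th power of the sum, every squarefree monomial
  of degree \<open>r\<close> has coefficient \<open>fact r\<close>.\<close>

lemma sympoly_only_at_le:
  assumes "finite P" "\<And>p. p \<in> P \<Longrightarrow> 0 \<le> x p"
  shows "sympoly (only_at r) x P \<le> (\<Sum>p\<in>P. x p) ^ r / fact r"
  using assms
proof (induction P arbitrary: r rule: finite_induct)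
  case empty
  then show ?case by (simp add: only_at_def)
next
  case (insert p P)
  let ?s = "\<Sum>p\<in>P. x p"
  have xp: "0 \<le> x p" "0 \<le> ?s" using insert.prems by (auto intro: sum_nonneg)
  show ?case
  proof (cases r)
    case 0
    then show ?thesis using insert.hyps by (simp add: sympoly_degree_0)
  next
    case (Suc r')
    have "sympoly (only_at r) x (insert p P) = sympoly (only_at (Suc r')) x P + x p * sympoly (only_at r') x P"
      using insert.hyps Suc by (simp add: sympoly_insert coeff_shift)
    also have "\<dots> \<le> ?s ^ Suc r' / fact (Suc r') + x p * (?s ^ r' / fact r')"
      using insert.prems xp by (intro add_mono mult_left_mono insert.IH) auto
    also have "\<dots> = (?s ^ Suc r' + real (Suc r') * x p * ?s ^ r') / fact (Suc r')"
    proof -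
      have "?s ^ r' / fact r' = real (Suc r') * ?s ^ r' / (real (Suc r') * fact r')"
        by (rule mult_divide_mult_cancel_left[symmetric]) simp
      also have "real (Suc r') * fact r' = fact (Suc r')" by simp
      finally have "x p * (?s ^ r' / fact r') = real (Suc r') * x p * ?s ^ r' / fact (Suc r')"
        by (simp only: times_divide_eq_right mult_ac)
      then show ?thesis by (simp only: add_divide_distrib)
    qed
    also have "\<dots> \<le> (?s + x p) ^ Suc r' / fact (Suc r')"
      using power_Suc_add_le[OF xp(2,1)] by (intro divide_right_mono) auto
    finally show ?thesis using insert.hyps Suc by (simp add: add.commute)
  qed
qed

text \<open>Every squarefree monomial of degree at most \<open>r\<close> occurs in the expansion of
  the right-hand side. This will bound the sieve remainder.\<close>

lemma sympoly_ones_upto_le: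
  assumes "finite P" "\<And>p. p \<in> P \<Longrightarrow> 0 \<le> x p"
  shows "sympoly (ones_upto r) x P \<le> (1 + (\<Sum>p\<in>P. x p)) ^ r"
  using assms
proof (induction P arbitrary: r rule: finite_induct)
  case empty
  then show ?case by (simp add: ones_upto_def)
next
  case (insert p P)
  let ?s = "\<Sum>p\<in>P. x p"
  have xp: "0 \<le> x p" "0 \<le> ?s" using insert.prems by (auto intro: sum_nonneg)
  show ?case
  proof (cases r)
    case 0
    then show ?thesis using insert.hyps by (simp add: sympoly_degree_0)
  next
    case (Suc r')
    have "sympoly (ones_upto r) x (insert p P) = sympoly (ones_upto (Suc r')) x P + x p * sympoly (ones_upto r') x P"
      using insert.hyps Suc by (simp add: sympoly_insert coeff_shift)
    also have "\<dots> \<le> (1 + ?s) ^ Suc r' + x p * (1 + ?s) ^ r'"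
      using insert.prems xp by (intro add_mono mult_left_mono insert.IH) auto
    also have "\<dots> = (1 + ?s + x p) * (1 + ?s) ^ r'" by (simp add: algebra_simps)
    also have "\<dots> \<le> (1 + ?s + x p) * (1 + ?s + x p) ^ r'"
      using xp by (intro mult_left_mono power_mono) auto
    finally show ?thesis using insert.hyps Suc by (simp add: add_ac)
  qed
qed

text \<open>Hooley's device. Multiplying blockwise lower bounds is invalid once a factor may be
  negative; instead the product of the upper bounds is corrected in one block at a time, so that
  only upper-bound factors are multiplied.\<close>

lemma prod_diff_le:
  fixes u v :: "'a \<Rightarrow> real"
  assumes "finite J" "\<And>j. j \<in> J \<Longrightarrow> 0 \<le> v j \<and> v j \<le> u j \<and> u j \<le> v j + w j"
  shows "(\<Prod>j\<in>J. u j) - (\<Sum>j\<in>J. w j * (\<Prod>i\<in>J - {j}. u i)) \<le> (\<Prod>j\<in>J. v j)"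
  using assms
proof (induction J rule: finite_induct)
  case empty
  then show ?case by simp
next
  case (insert a J)
  let ?U = "\<Prod>j\<in>J. u j" and ?V = "\<Prod>j\<in>J. v j" and ?S = "\<Sum>j\<in>J. w j * (\<Prod>i\<in>J - {j}. u i)"
  have IH: "?U - ?S \<le> ?V" using insert by auto
  have a: "0 \<le> v a" "v a \<le> u a" "u a \<le> v a + w a" using insert.prems by auto
  have VU: "0 \<le> ?V" "?V \<le> ?U" using insert.prems by (auto intro!: prod_nonneg prod_mono)
  have "(\<Sum>j\<in>insert a J. w j * (\<Prod>i\<in>insert a J - {j}. u i)) = w a * ?U + (\<Sum>j\<in>J. w j * (u a * (\<Prod>i\<in>J - {j}. u i)))"
  proof -
    have "(\<Prod>i\<in>insert a J - {j}. u i) = u a * (\<Prod>i\<in>J - {j}. u i)" if "j \<in> J" for j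
    proof -
      have "insert a J - {j} = insert a (J - {j})" using that insert.hyps by auto
      then show ?thesis using insert.hyps by simp
    qed
    moreover have "insert a J - {a} = J" using insert.hyps by auto
    ultimately show ?thesis using insert.hyps by simp
  qed
  also have "(\<Sum>j\<in>J. w j * (u a * (\<Prod>i\<in>J - {j}. u i))) = u a * ?S"
    by (simp add: sum_distrib_left mult_ac)
  finally have *: "(\<Sum>j\<in>insert a J. w j * (\<Prod>i\<in>insert a J - {j}. u i)) = w a * ?U + u a * ?S" .
  have "u a * (?U - ?S) \<le> u a * ?V" using a IH by (intro mult_left_mono) auto
  also have "\<dots> \<le> (v a + w a) * ?V" using a VU by (intro mult_right_mono) auto
  also have "\<dots> \<le> v a * ?V + w a * ?U"
  proof -
    have "w a * ?V \<le> w a * ?U" using a VU by (intro mult_left_mono) auto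
    then show ?thesis by (simp add: algebra_simps)
  qed
  finally show ?case using * insert.hyps by (simp add: algebra_simps)
qed

section \<open>Counting integers in residue classes\<close>

lemma card_residue_class:
  assumes "q > 0"
  shows "\<bar>real (card {m \<in> {1..N}. m mod q = a mod q}) - real N / real q\<bar> \<le> 1"
proof -
  \<comment> \<open>The representative is taken in 1..q rather than 0..q-1 because the count starts
    at 1.\<close>
  define b where "b = (if a mod q = 0 then q else a mod q)"
  have b: "1 \<le> b" "b \<le> q" using assms by (auto simp: b_def less_imp_le)
  have bm: "b mod q = a mod q" by (auto simp: b_def)
  have set: "{m \<in> {1..N}. m mod q = a mod q} = (\<lambda>t. b + q * t) ` {t. b + q * t \<le> N}"
  proof (intro set_eqI iffI)
    fix m assume m: "m \<in> {m \<in> {1..N}. m mod q = a mod q}"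
    have "m \<ge> b"
    proof (cases "a mod q = 0")
      case True
      then show ?thesis using m by (auto simp: b_def mod_eq_0_iff_dvd dvd_imp_le)
    next
      case False
      then have "b = m mod q" using m by (simp add: b_def)
      then show ?thesis by simp
    qed
    moreover have "m mod q = b mod q" using m bm by simp
    ultimately have "q dvd m - b" by (metis mod_eq_dvd_iff_nat)
    then obtain t where "m = b + q * t" using \<open>m \<ge> b\<close> by (metis dvdE le_add_diff_inverse)
    then show "m \<in> (\<lambda>t. b + q * t) ` {t. b + q * t \<le> N}" using m by auto
  next
    fix m assume "m \<in> (\<lambda>t. b + q * t) ` {t. b + q * t \<le> N}"
    then show "m \<in> {m \<in> {1..N}. m mod q = a mod q}" using b bm by auto
  qed
  have inj: "inj_on (\<lambda>t. b + q * t) A" for A using assms by (auto simp: inj_on_def)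
  have c: "card {m \<in> {1..N}. m mod q = a mod q} = card {t. b + q * t \<le> N}"
    unfolding set by (rule card_image[OF inj])
  show ?thesis
  proof (cases "b \<le> N")
    case False
    then have "{t. b + q * t \<le> N} = {}" by auto
    then have "card {m \<in> {1..N}. m mod q = a mod q} = 0" using c by simp
    moreover have "real N / real q \<le> 1" using False b assms by simp
    moreover have "real N / real q \<ge> 0" by simp
    ultimately show ?thesis by linarith
  next
    case True
    have "{t. b + q * t \<le> N} = {..(N - b) div q}"
      using True assms by (auto simp: less_eq_div_iff_mult_less_eq mult.commute)
    then have "card {m \<in> {1..N}. m mod q = a mod q} = (N - b) div q + 1" using c by simp
    moreover have "real ((N - b) div q) \<le> real (N - b) / real q" by (rule of_nat_div_le_of_nat)
    moreover have "real (N - b) / real q - 1 \<le> real ((N - b) div q)"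
      using floor_divide_of_nat_eq[of "N - b" q, where ?'a=real] floor_correct[of "real (N - b) / real q"] by linarith
    moreover have "real (N - b) / real q = real N / real q - real b / real q"
      using True by (simp add: diff_divide_distrib)
    moreover have "0 \<le> real b / real q" "real b / real q \<le> 1" using b assms by auto
    ultimately show ?thesis by linarith
  qed
qed

text \<open>By the Chinese remainder theorem the condition is a union of product-many classes, each
  miscounted by at most 1. The induction absorbs one \<open>p\<close> into the modulus, so
  \<open>q\<close> and \<open>a\<close> have to vary.\<close>

lemma card_residue_classes:
  assumes "finite S" "q > 0" "\<And>p. p \<in> S \<Longrightarrow> p > 0 \<and> R p \<subseteq> {..<p} \<and> coprime p q"
    and "\<And>p p'. p \<in> S \<Longrightarrow> p' \<in> S \<Longrightarrow> p \<noteq> p' \<Longrightarrow> coprime p p'"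
  shows "\<bar>real (card {m \<in> {1..N}. m mod q = a mod q \<and> (\<forall>p\<in>S. m mod p \<in> R p)})
            - real N / real q * (\<Prod>p\<in>S. real (card (R p)) / real p)\<bar> \<le> (\<Prod>p\<in>S. real (card (R p)))"
  using assms
proof (induction S arbitrary: q a rule: finite_induct)
  case empty
  then show ?case using card_residue_class[of q N a] by simp
next
  case (insert p S)
  have p: "p > 0" "R p \<subseteq> {..<p}" "coprime p q" using insert.prems by auto
  have finR: "finite (R p)" using p finite_subset by blast
  have "\<exists>c. [c = a] (mod q) \<and> [c = b] (mod p)" for b
    using binary_chinese_remainder_nat[of q p a b] p by (simp add: coprime_commute)
  then obtain c where c: "[c b = a] (mod q)" "[c b = b] (mod p)" for b by metis
  have crt: "m mod (q * p) = c b mod (q * p) \<longleftrightarrow> m mod q = a mod q \<and> m mod p = b" if "b \<in> R p" for m b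
  proof -
    have "b < p" using that p by auto
    have "m mod (q * p) = c b mod (q * p) \<longleftrightarrow> [m = c b] (mod q) \<and> [m = c b] (mod p)"
      using p coprime_cong_mult_nat[of m "c b" q p] cong_modulus_mult_nat[of m "c b"]
      by (metis cong_def coprime_commute mult.commute)
    also have "\<dots> \<longleftrightarrow> m mod q = a mod q \<and> m mod p = b"
      using c[of b] \<open>b < p\<close> by (simp add: cong_def)
    finally show ?thesis .
  qed
  let ?A = "\<lambda>b. {m \<in> {1..N}. m mod (q * p) = c b mod (q * p) \<and> (\<forall>p\<in>S. m mod p \<in> R p)}"
  let ?x = "\<Prod>p\<in>S. real (card (R p)) / real p" and ?g = "\<Prod>p\<in>S. real (card (R p))"
  have set: "{m \<in> {1..N}. m mod q = a mod q \<and> (\<forall>p\<in>insert p S. m mod p \<in> R p)} = (\<Union>b\<in>R p. ?A b)"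
    using crt by auto
  have "card (\<Union>b\<in>R p. ?A b) = (\<Sum>b\<in>R p. card (?A b))"
  proof (rule card_UN_disjoint[OF finR])
    show "\<forall>i\<in>R p. \<forall>j\<in>R p. i \<noteq> j \<longrightarrow> ?A i \<inter> ?A j = {}" using crt by auto
  qed auto
  then have eq: "real (card {m \<in> {1..N}. m mod q = a mod q \<and> (\<forall>p\<in>insert p S. m mod p \<in> R p)})
      - real N / real q * (\<Prod>p\<in>insert p S. real (card (R p)) / real p)
      = (\<Sum>b\<in>R p. real (card (?A b)) - real N / real (q * p) * ?x)"
    unfolding set using insert.hyps by (simp add: sum_subtractf)
  have "\<bar>\<Sum>b\<in>R p. real (card (?A b)) - real N / real (q * p) * ?x\<bar>
      \<le> (\<Sum>b\<in>R p. \<bar>real (card (?A b)) - real N / real (q * p) * ?x\<bar>)"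
    by (rule sum_abs)
  also have "\<dots> \<le> (\<Sum>b\<in>R p. ?g)"
  proof (rule sum_mono)
    fix b assume "b \<in> R p"
    show "\<bar>real (card (?A b)) - real N / real (q * p) * ?x\<bar> \<le> ?g"
    proof (rule insert.IH[of "q * p" "c b"])
      show "q * p > 0" using insert.prems(1) p by simp
      show "p' > 0 \<and> R p' \<subseteq> {..<p'} \<and> coprime p' (q * p)" if "p' \<in> S" for p'
      proof -
        have "p' \<noteq> p" using that insert.hyps by auto
        then have "coprime p' p" using insert.prems(3)[of p' p] that by auto
        moreover have "p' > 0" "R p' \<subseteq> {..<p'}" "coprime p' q" using insert.prems(2)[of p'] that by auto
        ultimately show ?thesis by auto
      qed
    qed (rule insert.prems(3); simp)
  qed
  also have "\<dots> = (\<Prod>p\<in>insert p S. real (card (R p)))" using insert.hyps by simp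
  finally show ?case unfolding eq .
qed

section \<open>A block sieve\<close>

lemma prod_sympoly_expand:
  assumes "finite J" "\<And>j. j \<in> J \<Longrightarrow> finite (P j)"
    and "\<And>i j. i \<in> J \<Longrightarrow> j \<in> J \<Longrightarrow> i \<noteq> j \<Longrightarrow> P i \<inter> P j = {}"
  shows "(\<Prod>j\<in>J. sympoly (c j) x (P j))
      = (\<Sum>\<sigma>\<in>(\<Pi>\<^sub>E j\<in>J. Pow (P j)). (\<Prod>j\<in>J. c j (card (\<sigma> j))) * (\<Prod>p\<in>(\<Union>j\<in>J. \<sigma> j). x p))"
proof -
  have "(\<Prod>j\<in>J. sympoly (c j) x (P j))
      = (\<Sum>\<sigma>\<in>(\<Pi>\<^sub>E j\<in>J. Pow (P j)). \<Prod>j\<in>J. c j (card (\<sigma> j)) * (\<Prod>p\<in>\<sigma> j. x p))"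
    unfolding sympoly_def using assms by (intro prod_sum_PiE) auto
  also have "\<dots> = (\<Sum>\<sigma>\<in>(\<Pi>\<^sub>E j\<in>J. Pow (P j)). (\<Prod>j\<in>J. c j (card (\<sigma> j))) * (\<Prod>p\<in>(\<Union>j\<in>J. \<sigma> j). x p))"
  proof (rule sum.cong[OF refl])
    fix \<sigma> assume \<sigma>: "\<sigma> \<in> (\<Pi>\<^sub>E j\<in>J. Pow (P j))"
    then have sub: "\<sigma> j \<subseteq> P j" if "j \<in> J" for j using that by auto
    have "(\<Prod>p\<in>(\<Union>j\<in>J. \<sigma> j). x p) = (\<Prod>j\<in>J. \<Prod>p\<in>\<sigma> j. x p)"
    proof (rule prod.UNION_disjoint)
      show "\<forall>i\<in>J. finite (\<sigma> i)" using sub assms(2) finite_subset by blast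
      show "\<forall>i\<in>J. \<forall>j\<in>J. i \<noteq> j \<longrightarrow> \<sigma> i \<inter> \<sigma> j = {}" using sub assms(3) by blast
    qed (use assms in auto)
    then show "(\<Prod>j\<in>J. c j (card (\<sigma> j)) * (\<Prod>p\<in>\<sigma> j. x p))
        = (\<Prod>j\<in>J. c j (card (\<sigma> j))) * (\<Prod>p\<in>(\<Union>j\<in>J. \<sigma> j). x p)"
      by (simp add: prod.distrib)
  qed
  finally show ?thesis .
qed

lemma prod_of_bool:
  assumes "finite A"
  shows "(\<Prod>p\<in>A. of_bool (Q p) :: real) = of_bool (\<forall>p\<in>A. Q p)"
  using assms by (induction A rule: finite_induct) auto

text \<open>The weights are multilinear in \<open>x\<close>, so averaging over \<open>m\<close>
  replaces indicators by densities up to the rounding errors of the residue counts. Arbitrary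
  \<open>c\<close> and \<open>q\<close> allow the same statement to be used for the main weight, its
  corrections and the sieve in a progression.\<close>

lemma sum_prod_sympoly_residues:
  assumes J: "finite J" "\<And>j. j \<in> J \<Longrightarrow> finite (P j)"
    and disj: "\<And>i j. i \<in> J \<Longrightarrow> j \<in> J \<Longrightarrow> i \<noteq> j \<Longrightarrow> P i \<inter> P j = {}"
    and "q > 0" and R: "\<And>j p. j \<in> J \<Longrightarrow> p \<in> P j \<Longrightarrow> prime p \<and> R p \<subseteq> {..<p} \<and> coprime p q"
  shows "\<bar>(\<Sum>m | m \<in> {1..N} \<and> m mod q = a mod q. \<Prod>j\<in>J. sympoly (c j) (\<lambda>p. of_bool (m mod p \<in> R p)) (P j))
      - real N / real q * (\<Prod>j\<in>J. sympoly (c j) (\<lambda>p. real (card (R p)) / real p) (P j))\<bar>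
      \<le> (\<Prod>j\<in>J. sympoly (\<lambda>i. \<bar>c j i\<bar>) (\<lambda>p. real (card (R p))) (P j))"
proof -
  define A where "A = (\<Pi>\<^sub>E j\<in>J. Pow (P j))"
  define C where "C \<sigma> = (\<Prod>j\<in>J. c j (card (\<sigma> j)))" for \<sigma> :: "'a \<Rightarrow> nat set"
  define T where "T \<sigma> = (\<Union>j\<in>J. \<sigma> j)" for \<sigma> :: "'a \<Rightarrow> nat set"
  define M where "M = {m. m \<in> {1..N} \<and> m mod q = a mod q}"
  have finM: "finite M" by (rule finite_subset[of _ "{1..N}"]) (auto simp: M_def)
  have finT: "finite (T \<sigma>)" if "\<sigma> \<in> A" for \<sigma>
    using that J unfolding T_def A_def by (auto intro!: finite_UN_I) (meson PiE_E Pow_iff finite_subset)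
  define K where "K \<sigma> = real (card {m \<in> {1..N}. m mod q = a mod q \<and> (\<forall>p\<in>T \<sigma>. m mod p \<in> R p)})" for \<sigma>
  have count: "(\<Sum>m\<in>M. \<Prod>p\<in>T \<sigma>. of_bool (m mod p \<in> R p) :: real) = K \<sigma>" if "\<sigma> \<in> A" for \<sigma>
  proof -
    have "(\<Sum>m\<in>M. \<Prod>p\<in>T \<sigma>. of_bool (m mod p \<in> R p) :: real) = (\<Sum>m\<in>M. of_bool (\<forall>p\<in>T \<sigma>. m mod p \<in> R p))"
      using prod_of_bool[OF finT[OF that]] by simp
    also have "\<dots> = real (card (M \<inter> {m. \<forall>p\<in>T \<sigma>. m mod p \<in> R p}))"
      using finM by (subst sum_of_bool_eq) simp_all
    also have "M \<inter> {m. \<forall>p\<in>T \<sigma>. m mod p \<in> R p} = {m \<in> {1..N}. m mod q = a mod q \<and> (\<forall>p\<in>T \<sigma>. m mod p \<in> R p)}"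
      by (auto simp: M_def)
    finally show ?thesis unfolding K_def .
  qed
  have bound: "\<bar>K \<sigma> - real N / real q * (\<Prod>p\<in>T \<sigma>. real (card (R p)) / real p)\<bar> \<le> (\<Prod>p\<in>T \<sigma>. real (card (R p)))"
    if "\<sigma> \<in> A" for \<sigma>
    unfolding K_def
  proof (rule card_residue_classes[OF finT[OF that] \<open>q > 0\<close>])
    have sub: "\<exists>j\<in>J. p \<in> P j" if "p \<in> T \<sigma>" for p using \<open>\<sigma> \<in> A\<close> that by (auto simp: T_def A_def)
    show "p > 0 \<and> R p \<subseteq> {..<p} \<and> coprime p q" if "p \<in> T \<sigma>" for p
      using sub[OF that] R prime_gt_0_nat by blast
    show "coprime p p'" if "p \<in> T \<sigma>" "p' \<in> T \<sigma>" "p \<noteq> p'" for p p'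
      using sub[OF that(1)] sub[OF that(2)] that(3) R primes_coprime by blast
  qed
  have "(\<Sum>m\<in>M. \<Prod>j\<in>J. sympoly (c j) (\<lambda>p. of_bool (m mod p \<in> R p)) (P j))
      = (\<Sum>m\<in>M. \<Sum>\<sigma>\<in>A. C \<sigma> * (\<Prod>p\<in>T \<sigma>. of_bool (m mod p \<in> R p)))"
    unfolding A_def C_def T_def using J disj by (subst prod_sympoly_expand) auto
  also have "\<dots> = (\<Sum>\<sigma>\<in>A. C \<sigma> * (\<Sum>m\<in>M. \<Prod>p\<in>T \<sigma>. of_bool (m mod p \<in> R p)))"
    by (subst sum.swap) (simp add: sum_distrib_left)
  also have "\<dots> = (\<Sum>\<sigma>\<in>A. C \<sigma> * K \<sigma>)" using count by simp
  finally have 1: "(\<Sum>m\<in>M. \<Prod>j\<in>J. sympoly (c j) (\<lambda>p. of_bool (m mod p \<in> R p)) (P j)) = (\<Sum>\<sigma>\<in>A. C \<sigma> * K \<sigma>)" .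
  have 2: "real N / real q * (\<Prod>j\<in>J. sympoly (c j) (\<lambda>p. real (card (R p)) / real p) (P j))
      = (\<Sum>\<sigma>\<in>A. C \<sigma> * (real N / real q * (\<Prod>p\<in>T \<sigma>. real (card (R p)) / real p)))"
    unfolding A_def C_def T_def using J disj
    by (subst prod_sympoly_expand) (auto simp: sum_distrib_left mult_ac)
  have 3: "(\<Prod>j\<in>J. sympoly (\<lambda>i. \<bar>c j i\<bar>) (\<lambda>p. real (card (R p))) (P j)) = (\<Sum>\<sigma>\<in>A. \<bar>C \<sigma>\<bar> * (\<Prod>p\<in>T \<sigma>. real (card (R p))))"
    unfolding A_def C_def T_def using J disj
    by (subst prod_sympoly_expand) (auto simp: abs_prod)
  have "\<bar>\<Sum>\<sigma>\<in>A. C \<sigma> * (K \<sigma> - real N / real q * (\<Prod>p\<in>T \<sigma>. real (card (R p)) / real p))\<bar>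
      \<le> (\<Sum>\<sigma>\<in>A. \<bar>C \<sigma>\<bar> * (\<Prod>p\<in>T \<sigma>. real (card (R p))))"
    using bound by (intro order.trans[OF sum_abs] sum_mono) (auto simp: abs_mult intro!: mult_left_mono)
  then show ?thesis unfolding 2 3 1[unfolded M_def] by (simp add: sum_subtractf right_diff_distrib)
qed

text \<open>The Brun--Hooley sieve: inclusion-exclusion is truncated separately in each block \<open>P j\<close>, at the
  even depth \<open>r j\<close>.\<close>

locale block_sieve =
  fixes J :: "'j set" and P :: "'j \<Rightarrow> nat set" and R :: "nat \<Rightarrow> nat set"
    and r :: "'j \<Rightarrow> nat" and \<epsilon> :: "'j \<Rightarrow> real" and D :: real
  assumes finite_blocks: "finite J" "\<And>j. j \<in> J \<Longrightarrow> finite (P j)"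
    and blocks_disjoint: "\<And>i j. i \<in> J \<Longrightarrow> j \<in> J \<Longrightarrow> i \<noteq> j \<Longrightarrow> P i \<inter> P j = {}"
    and block_prime: "\<And>j p. j \<in> J \<Longrightarrow> p \<in> P j \<Longrightarrow> prime p"
    and residues: "\<And>j p. j \<in> J \<Longrightarrow> p \<in> P j \<Longrightarrow> R p \<subseteq> {..<p}"
    and few_residues: "\<And>j p. j \<in> J \<Longrightarrow> p \<in> P j \<Longrightarrow> 2 * card (R p) \<le> p"
    and even_depth: "\<And>j. j \<in> J \<Longrightarrow> even (r j)"
    and eps_nonneg: "\<And>j. j \<in> J \<Longrightarrow> 0 \<le> \<epsilon> j"
    and tail: "\<And>j. j \<in> J \<Longrightarrow> sympoly (only_at (Suc (r j))) (\<lambda>p. real (card (R p)) / real p) (P j)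
      \<le> \<epsilon> j * (\<Prod>p\<in>P j. 1 - real (card (R p)) / real p)"
    and eps_sum: "(\<Sum>j\<in>J. \<epsilon> j) \<le> 1 / 2"
    and level: "(\<Prod>j\<in>J. (1 + (\<Sum>p\<in>P j. real (card (R p)))) ^ Suc (r j)) \<le> D"
begin

definition dens :: "nat \<Rightarrow> real" where "dens p = real (card (R p)) / real p"

definition sifted :: "nat \<Rightarrow> bool" where "sifted m \<longleftrightarrow> (\<forall>j\<in>J. \<forall>p\<in>P j. m mod p \<notin> R p)"

definition V :: real where "V = (\<Prod>j\<in>J. \<Prod>p\<in>P j. 1 - dens p)"

lemma dens_bounds:
  assumes "j \<in> J" "p \<in> P j"
  shows "0 \<le> dens p" "dens p \<le> 1 / 2"
proof -
  have "p > 0" using block_prime[OF assms] prime_gt_0_nat by blast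
  then show "dens p \<le> 1 / 2" using few_residues[OF assms] by (simp add: dens_def field_simps)
qed (simp add: dens_def)

text \<open>Degree \<open>Suc (r j)\<close> covers both kinds of weight: the sum truncated at
  \<open>r j\<close> and the correction of exact degree \<open>Suc (r j)\<close>. Subsets
  \<open>Q j\<close> are allowed because primes dividing a modulus are dropped later.\<close>

lemma error_le:
  assumes "\<And>j. j \<in> J \<Longrightarrow> Q j \<subseteq> P j"
    and "\<And>j i. j \<in> J \<Longrightarrow> \<bar>c j i\<bar> \<le> ones_upto (Suc (r j)) i"
  shows "(\<Prod>j\<in>J. sympoly (\<lambda>i. \<bar>c j i\<bar>) (\<lambda>p. real (card (R p))) (Q j)) \<le> D"
proof -
  have "(\<Prod>j\<in>J. sympoly (\<lambda>i. \<bar>c j i\<bar>) (\<lambda>p. real (card (R p))) (Q j))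
      \<le> (\<Prod>j\<in>J. (1 + (\<Sum>p\<in>P j. real (card (R p)))) ^ Suc (r j))"
  proof (rule prod_mono)
    fix j assume j: "j \<in> J"
    have "sympoly (\<lambda>i. \<bar>c j i\<bar>) (\<lambda>p. real (card (R p))) (Q j) \<le> sympoly (\<lambda>i. \<bar>c j i\<bar>) (\<lambda>p. real (card (R p))) (P j)"
      using assms j finite_blocks by (intro sympoly_mono_set) auto
    also have "\<dots> \<le> sympoly (ones_upto (Suc (r j))) (\<lambda>p. real (card (R p))) (P j)"
      using assms j by (intro sympoly_mono) auto
    also have "\<dots> \<le> (1 + (\<Sum>p\<in>P j. real (card (R p)))) ^ Suc (r j)"
      using finite_blocks j by (intro sympoly_ones_upto_le) auto
    finally show "0 \<le> sympoly (\<lambda>i. \<bar>c j i\<bar>) (\<lambda>p. real (card (R p))) (Q j) \<and>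
        sympoly (\<lambda>i. \<bar>c j i\<bar>) (\<lambda>p. real (card (R p))) (Q j) \<le> (1 + (\<Sum>p\<in>P j. real (card (R p)))) ^ Suc (r j)"
      by (auto intro: sympoly_nonneg)
  qed
  then show ?thesis using level by linarith
qed

lemma V_pos: "0 < V"
proof -
  have "0 < 1 - dens p" if "j \<in> J" "p \<in> P j" for j p using dens_bounds[OF that] by simp
  then show ?thesis unfolding V_def by (intro prod_pos) auto
qed

lemma prod_not_residue:
  assumes "\<And>j. j \<in> J \<Longrightarrow> Q j \<subseteq> P j"
  shows "(\<Prod>j\<in>J. \<Prod>p\<in>Q j. 1 - of_bool (m mod p \<in> R p) :: real) = of_bool (\<forall>j\<in>J. \<forall>p\<in>Q j. m mod p \<notin> R p)"
proof -
  have fin: "finite (Q j)" if "j \<in> J" for j using assms that finite_blocks finite_subset by blast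
  have "(\<Prod>p\<in>Q j. 1 - of_bool (m mod p \<in> R p) :: real) = of_bool (\<forall>p\<in>Q j. m mod p \<notin> R p)" if "j \<in> J" for j
    using prod_of_bool[OF fin[OF that], of "\<lambda>p. m mod p \<notin> R p"] by (simp add: of_bool_not_iff)
  then show ?thesis using prod_of_bool[OF finite_blocks(1), of "\<lambda>j. \<forall>p\<in>Q j. m mod p \<notin> R p"] by simp
qed

text \<open>\<open>prod_diff_le\<close> is applied for each \<open>m\<close> and summed. By
  \<open>tail\<close>, the correction in block \<open>j\<close> is at most
  \<open>\<epsilon> j\<close> times the main product, so \<open>eps_sum\<close> loses at most half
  of it. The main product and the \<open>card J\<close> corrections cost one remainder
  \<open>D\<close> each.\<close>

theorem card_sifted_ge:
  "real N * V * (1 / 2) - (1 + real (card J)) * D \<le> real (card {m \<in> {1..N}. sifted m})"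
proof -
  define ind where "ind m p = (of_bool (m mod p \<in> R p) :: real)" for m p
  define u where "u m j = sympoly (alt_upto (r j)) (ind m) (P j)" for m j
  define w where "w m j = sympoly (only_at (Suc (r j))) (ind m) (P j)" for m j
  define U where "U j = sympoly (alt_upto (r j)) dens (P j)" for j
  define W where "W j = sympoly (only_at (Suc (r j))) dens (P j)" for j
  \<comment> \<open>Coefficients of the correction in block \<open>j\<close>: the exact degree
    there, the truncated alternating sum in every other block.\<close>
  define c where "c j i = (if i = j then only_at (Suc (r i)) else alt_upto (r i))" for i j
  have cop: "prime p \<and> R p \<subseteq> {..<p} \<and> coprime p 1" if "j \<in> J" "p \<in> P j" for j p
    using that block_prime residues by auto
  have exp: "\<bar>(\<Sum>m\<in>{1..N}. \<Prod>j\<in>J. sympoly (d j) (ind m) (P j)) - real N * (\<Prod>j\<in>J. sympoly (d j) dens (P j))\<bar> \<le> D"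
    if "\<And>j i. j \<in> J \<Longrightarrow> \<bar>d j i\<bar> \<le> ones_upto (Suc (r j)) i" for d
  proof -
    have "\<bar>(\<Sum>m | m \<in> {1..N} \<and> m mod 1 = 0 mod 1. \<Prod>j\<in>J. sympoly (d j) (ind m) (P j))
        - real N / real 1 * (\<Prod>j\<in>J. sympoly (d j) dens (P j))\<bar> \<le> D"
      unfolding ind_def dens_def
      by (rule order.trans[OF sum_prod_sympoly_residues[OF finite_blocks blocks_disjoint _ cop] error_le[OF _ that]]) auto
    moreover have "{m. m \<in> {1..N} \<and> m mod 1 = (0::nat) mod 1} = {1..N}" by auto
    ultimately show ?thesis by simp
  qed
  have prod_c: "(\<Prod>i\<in>J. sympoly (c j i) x (P i))
      = sympoly (only_at (Suc (r j))) x (P j) * (\<Prod>i\<in>J - {j}. sympoly (alt_upto (r i)) x (P i))"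
    if "j \<in> J" for j and x :: "nat \<Rightarrow> real"
    using that finite_blocks by (subst prod.remove[of _ j]) (auto simp: c_def intro!: prod.cong)
  have "(\<Sum>m\<in>{1..N}. (\<Prod>j\<in>J. u m j) - (\<Sum>j\<in>J. w m j * (\<Prod>i\<in>J - {j}. u m i)))
      \<le> (\<Sum>m\<in>{1..N}. of_bool (sifted m))"
  proof (rule sum_mono)
    fix m
    have "(\<Prod>j\<in>J. u m j) - (\<Sum>j\<in>J. w m j * (\<Prod>i\<in>J - {j}. u m i)) \<le> (\<Prod>j\<in>J. \<Prod>p\<in>P j. 1 - ind m p)"
    proof (rule prod_diff_le[OF finite_blocks(1)], intro conjI)
      fix j assume j: "j \<in> J"
      have i: "0 \<le> ind m p \<and> ind m p \<le> 1" for p by (simp add: ind_def)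
      then show "0 \<le> (\<Prod>p\<in>P j. 1 - ind m p)" by (auto intro: prod_nonneg)
      show "(\<Prod>p\<in>P j. 1 - ind m p) \<le> u m j" "u m j \<le> (\<Prod>p\<in>P j. 1 - ind m p) + w m j"
        unfolding u_def w_def using bonferroni_even[of "P j" "ind m" "r j"] i finite_blocks(2)[OF j] even_depth[OF j] by auto
    qed
    also have "\<dots> = of_bool (sifted m)"
      unfolding ind_def sifted_def by (rule prod_not_residue) auto
    finally show "(\<Prod>j\<in>J. u m j) - (\<Sum>j\<in>J. w m j * (\<Prod>i\<in>J - {j}. u m i)) \<le> of_bool (sifted m)" .
  qed
  also have "(\<Sum>m\<in>{1..N}. of_bool (sifted m) :: real) = real (card {m \<in> {1..N}. sifted m})"
    by (subst sum_of_bool_eq) (auto simp: Int_def)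
  finally have A: "(\<Sum>m\<in>{1..N}. \<Prod>j\<in>J. u m j) - (\<Sum>j\<in>J. \<Sum>m\<in>{1..N}. w m j * (\<Prod>i\<in>J - {j}. u m i))
      \<le> real (card {m \<in> {1..N}. sifted m})"
    by (simp add: sum_subtractf sum.swap[of _ J])
  have B: "real N * (\<Prod>j\<in>J. U j) - D \<le> (\<Sum>m\<in>{1..N}. \<Prod>j\<in>J. u m j)"
    using exp[of "\<lambda>j. alt_upto (r j)"] abs_coeff_le unfolding u_def U_def by (auto simp: abs_le_iff)
  have V_le_U: "0 \<le> (\<Prod>p\<in>P j. 1 - dens p)" "(\<Prod>p\<in>P j. 1 - dens p) \<le> U j" if "j \<in> J" for j
  proof -
    have d: "0 \<le> dens p \<and> dens p \<le> 1" if "p \<in> P j" for p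
      using dens_bounds[OF \<open>j \<in> J\<close> that] by simp
    then show "0 \<le> (\<Prod>p\<in>P j. 1 - dens p)" by (auto intro: prod_nonneg)
    show "(\<Prod>p\<in>P j. 1 - dens p) \<le> U j"
      unfolding U_def using d finite_blocks even_depth that by (intro bonferroni_even) auto
  qed
  have C: "(\<Sum>m\<in>{1..N}. w m j * (\<Prod>i\<in>J - {j}. u m i)) \<le> real N * (\<epsilon> j * (\<Prod>j\<in>J. U j)) + D" if j: "j \<in> J" for j
  proof -
    have "\<bar>c j i k\<bar> \<le> ones_upto (Suc (r i)) k" for i k using abs_coeff_le by (simp add: c_def)
    then have "(\<Sum>m\<in>{1..N}. w m j * (\<Prod>i\<in>J - {j}. u m i)) \<le> real N * (W j * (\<Prod>i\<in>J - {j}. U i)) + D"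
      using exp[of "c j"] unfolding prod_c[OF j] u_def w_def U_def W_def by (auto simp: abs_le_iff)
    moreover have "W j * (\<Prod>i\<in>J - {j}. U i) \<le> \<epsilon> j * (\<Prod>j\<in>J. U j)"
    proof -
      have "W j \<le> \<epsilon> j * (\<Prod>p\<in>P j. 1 - dens p)" unfolding W_def dens_def by (rule tail[OF j])
      also have "\<dots> \<le> \<epsilon> j * U j" using V_le_U[OF j] eps_nonneg[OF j] by (intro mult_left_mono)
      finally have "W j * (\<Prod>i\<in>J - {j}. U i) \<le> \<epsilon> j * U j * (\<Prod>i\<in>J - {j}. U i)"
        using V_le_U by (intro mult_right_mono prod_nonneg) force+
      then show ?thesis using j finite_blocks by (simp add: prod.remove mult.assoc)
    qed
    then have "real N * (W j * (\<Prod>i\<in>J - {j}. U i)) \<le> real N * (\<epsilon> j * (\<Prod>j\<in>J. U j))"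
      by (intro mult_left_mono) auto
    ultimately show ?thesis by linarith
  qed
  have "(\<Sum>j\<in>J. \<Sum>m\<in>{1..N}. w m j * (\<Prod>i\<in>J - {j}. u m i)) \<le> (\<Sum>j\<in>J. real N * (\<epsilon> j * (\<Prod>j\<in>J. U j)) + D)"
    by (rule sum_mono) (rule C)
  also have "\<dots> = real N * (\<Prod>j\<in>J. U j) * (\<Sum>j\<in>J. \<epsilon> j) + real (card J) * D"
    by (simp add: sum.distrib sum_distrib_left sum_distrib_right mult_ac)
  also have "\<dots> \<le> real N * (\<Prod>j\<in>J. U j) * (1/2) + real (card J) * D"
  proof -
    have "(\<Prod>j\<in>J. U j) \<ge> 0" using V_le_U by (intro prod_nonneg) force
    then show ?thesis using eps_sum by (intro add_right_mono mult_left_mono) auto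
  qed
  finally have E: "(\<Sum>j\<in>J. \<Sum>m\<in>{1..N}. w m j * (\<Prod>i\<in>J - {j}. u m i))
      \<le> real N * (\<Prod>j\<in>J. U j) * (1/2) + real (card J) * D" .
  have "V \<le> (\<Prod>j\<in>J. U j)" unfolding V_def using V_le_U by (intro prod_mono) auto
  then have "real N * V \<le> real N * (\<Prod>j\<in>J. U j)" by (intro mult_left_mono) auto
  then show ?thesis using A B E by (simp add: algebra_simps)
qed

text \<open>The sieve weights are not monotone in the set of sieving primes, so the primes dividing \<open>e\<close> are
  dropped from the sieving condition before passing to the weights.\<close>

theorem card_sifted_residue_class_le:
  assumes "e > 0"
  shows "real (card {m \<in> {1..N}. m mod e = a mod e \<and> sifted m})
      \<le> 2 * real N * V * (2 ^ card (prime_factors e) / real e) + D"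
proof -
  define Q where "Q j = P j - prime_factors e" for j
  define ind where "ind m p = (of_bool (m mod p \<in> R p) :: real)" for m p
  define M where "M = {m. m \<in> {1..N} \<and> m mod e = a mod e}"
  have finM: "finite M" by (rule finite_subset[of _ "{1..N}"]) (auto simp: M_def)
  have QP: "Q j \<subseteq> P j" for j by (auto simp: Q_def)
  have finQ: "finite (Q j)" if "j \<in> J" for j using finite_blocks that by (simp add: Q_def)
  have QR: "prime p \<and> R p \<subseteq> {..<p} \<and> coprime p e" if "j \<in> J" "p \<in> Q j" for j p
  proof -
    have "prime p" "p \<notin> prime_factors e" using that block_prime by (auto simp: Q_def)
    then have "coprime p e" using assms by (intro prime_imp_coprime) (auto simp: prime_factors_dvd)
    then show ?thesis using that block_prime residues by (auto simp: Q_def)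
  qed
  have db: "0 \<le> dens p \<and> dens p \<le> 1" if "j \<in> J" "p \<in> P j" for j p
    using dens_bounds[OF that] by simp
  have "real (card {m \<in> {1..N}. m mod e = a mod e \<and> sifted m}) = (\<Sum>m\<in>M. of_bool (sifted m))"
    using finM by (subst sum_of_bool_eq) (auto simp: M_def Int_def conj_assoc)
  also have "\<dots> \<le> (\<Sum>m\<in>M. \<Prod>j\<in>J. sympoly (alt_upto (r j)) (ind m) (Q j))"
  proof (rule sum_mono)
    fix m
    have "(of_bool (sifted m) :: real) \<le> of_bool (\<forall>j\<in>J. \<forall>p\<in>Q j. m mod p \<notin> R p)"
      using QP by (auto simp: sifted_def)
    also have "\<dots> = (\<Prod>j\<in>J. \<Prod>p\<in>Q j. 1 - ind m p)"
      unfolding ind_def by (rule prod_not_residue[symmetric]) (rule QP)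
    also have "\<dots> \<le> (\<Prod>j\<in>J. sympoly (alt_upto (r j)) (ind m) (Q j))"
      using finQ even_depth
      by (intro prod_mono conjI bonferroni_even prod_nonneg) (auto simp: ind_def)
    finally show "of_bool (sifted m) \<le> (\<Prod>j\<in>J. sympoly (alt_upto (r j)) (ind m) (Q j))" .
  qed
  also have "\<dots> \<le> real N / real e * (\<Prod>j\<in>J. sympoly (alt_upto (r j)) dens (Q j)) + D"
  proof -
    have "\<bar>(\<Sum>m\<in>M. \<Prod>j\<in>J. sympoly (alt_upto (r j)) (ind m) (Q j))
        - real N / real e * (\<Prod>j\<in>J. sympoly (alt_upto (r j)) dens (Q j))\<bar> \<le> D"
      unfolding ind_def dens_def M_def
    proof (rule order.trans[OF sum_prod_sympoly_residues error_le])
      show "Q i \<inter> Q j = {}" if "i \<in> J" "j \<in> J" "i \<noteq> j" for i j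
        using blocks_disjoint[OF that] QP by blast
    qed (use finite_blocks finQ assms QR QP abs_coeff_le in auto)
    then show ?thesis by (auto simp: abs_le_iff)
  qed
  finally have count: "real (card {m \<in> {1..N}. m mod e = a mod e \<and> sifted m})
      \<le> real N / real e * (\<Prod>j\<in>J. sympoly (alt_upto (r j)) dens (Q j)) + D" .
  have "(\<Prod>j\<in>J. sympoly (alt_upto (r j)) dens (Q j))
      \<le> (\<Prod>j\<in>J. (1 + \<epsilon> j) * (2 ^ card (P j \<inter> prime_factors e) * (\<Prod>p\<in>P j. 1 - dens p)))"
  proof (rule prod_mono, intro conjI)
    fix j assume j: "j \<in> J"
    let ?VQ = "\<Prod>p\<in>Q j. 1 - dens p" and ?VP = "\<Prod>p\<in>P j. 1 - dens p"
    have dQ: "0 \<le> dens p \<and> dens p \<le> 1" if "p \<in> Q j" for p using db[OF j] QP that by blast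
    have VQ0: "0 \<le> ?VQ" using dQ by (auto intro: prod_nonneg)
    then show "0 \<le> sympoly (alt_upto (r j)) dens (Q j)"
      using bonferroni_even(1)[of "Q j" dens "r j"] dQ finQ[OF j] even_depth[OF j] by force
    have split: "?VP = ?VQ * (\<Prod>p\<in>P j \<inter> prime_factors e. 1 - dens p)"
      using prod.Int_Diff[OF finite_blocks(2)[OF j], of _ "prime_factors e"] by (simp add: Q_def mult.commute)
    have le1: "(\<Prod>p\<in>P j \<inter> prime_factors e. 1 - dens p) \<le> 1"
      using db[OF j] by (intro prod_le_1) auto
    \<comment> \<open>Restoring a dropped prime costs a factor of at most 2, as its density is at
      most 1/2. This is the origin of the power of 2 in the conclusion.\<close>
    have ge: "(1/2) ^ card (P j \<inter> prime_factors e) \<le> (\<Prod>p\<in>P j \<inter> prime_factors e. 1 - dens p)"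
    proof -
      have "(\<Prod>p\<in>P j \<inter> prime_factors e. 1 / 2 :: real) \<le> (\<Prod>p\<in>P j \<inter> prime_factors e. 1 - dens p)"
      proof (rule prod_mono)
        fix p assume "p \<in> P j \<inter> prime_factors e"
        then show "0 \<le> (1/2::real) \<and> 1/2 \<le> 1 - dens p" using dens_bounds[OF j, of p] by auto
      qed
      then show ?thesis by simp
    qed
    have VPQ: "?VP \<le> ?VQ" using mult_left_mono[OF le1 VQ0] split by simp
    have "?VQ * (1/2) ^ card (P j \<inter> prime_factors e) \<le> ?VP"
      unfolding split using ge VQ0 by (rule mult_left_mono)
    then have VQP: "?VQ \<le> 2 ^ card (P j \<inter> prime_factors e) * ?VP"
      by (simp add: power_one_over field_simps)
    have "sympoly (alt_upto (r j)) dens (Q j) \<le> ?VQ + sympoly (only_at (Suc (r j))) dens (Q j)"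
      using dQ finQ[OF j] even_depth[OF j] by (intro bonferroni_even) auto
    also have "sympoly (only_at (Suc (r j))) dens (Q j) \<le> sympoly (only_at (Suc (r j))) dens (P j)"
      using finite_blocks j QP db[OF j] only_at_nonneg by (intro sympoly_mono_set) auto
    also have "\<dots> \<le> \<epsilon> j * ?VP" unfolding dens_def by (rule tail[OF j])
    also have "\<dots> \<le> \<epsilon> j * ?VQ" using VPQ eps_nonneg[OF j] by (rule mult_left_mono)
    also have "?VQ + \<epsilon> j * ?VQ = (1 + \<epsilon> j) * ?VQ" by (simp add: algebra_simps)
    also have "\<dots> \<le> (1 + \<epsilon> j) * (2 ^ card (P j \<inter> prime_factors e) * ?VP)"
      using VQP eps_nonneg[OF j] by (intro mult_left_mono) auto
    finally show "sympoly (alt_upto (r j)) dens (Q j) \<le> (1 + \<epsilon> j) * (2 ^ card (P j \<inter> prime_factors e) * ?VP)"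
      by simp
  qed
  also have "\<dots> = (\<Prod>j\<in>J. 1 + \<epsilon> j) * (2 ^ (\<Sum>j\<in>J. card (P j \<inter> prime_factors e)) * V)"
    by (simp add: prod.distrib V_def power_sum)
  also have "\<dots> \<le> 2 * (2 ^ card (prime_factors e) * V)"
  proof (intro mult_mono)
    have "(\<Prod>j\<in>J. 1 + \<epsilon> j) \<le> (\<Prod>j\<in>J. exp (\<epsilon> j))"
      using eps_nonneg exp_ge_add_one_self by (intro prod_mono) (auto intro: add_nonneg_nonneg)
    also have "\<dots> = exp (\<Sum>j\<in>J. \<epsilon> j)" using finite_blocks by (simp add: exp_sum)
    also have "\<dots> \<le> exp (1 / 2)" using eps_sum by simp
    also have "\<dots> \<le> 2" by (rule exp_half_le2)
    finally show "(\<Prod>j\<in>J. 1 + \<epsilon> j) \<le> 2" .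
    have "(\<Sum>j\<in>J. card (P j \<inter> prime_factors e)) = card (\<Union>j\<in>J. P j \<inter> prime_factors e)"
      using finite_blocks blocks_disjoint by (intro card_UN_disjoint[symmetric]) blast+
    also have "\<dots> \<le> card (prime_factors e)" by (intro card_mono) auto
    finally show "(2::real) ^ (\<Sum>j\<in>J. card (P j \<inter> prime_factors e)) \<le> 2 ^ card (prime_factors e)"
      by (intro power_increasing) auto
  qed (use V_pos in auto)
  finally have "real N / real e * (\<Prod>j\<in>J. sympoly (alt_upto (r j)) dens (Q j))
      \<le> real N / real e * (2 * (2 ^ card (prime_factors e) * V))"
    by (intro mult_left_mono) auto
  then show ?thesis using count by (simp add: mult_ac)
qed

end

section \<open>Sums over primes and Rankin's trick\<close>

lemma sum_ln_prime_factors_le: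
  assumes "n > (0::nat)"
  shows "(\<Sum>p\<in>prime_factors n. ln (real p)) \<le> ln (real n)"
proof -
  have "(\<Prod>p\<in>prime_factors n. p ^ multiplicity p n) = n"
    using prod_prime_factors[of n] assms by simp
  then have "real n = real (\<Prod>p\<in>prime_factors n. p ^ multiplicity p n)" by (simp only:)
  also have "\<dots> = (\<Prod>p\<in>prime_factors n. real p ^ multiplicity p n)" by simp
  finally have n: "real n = (\<Prod>p\<in>prime_factors n. real p ^ multiplicity p n)" .
  have "ln (real n) = (\<Sum>p\<in>prime_factors n. ln (real p ^ multiplicity p n))"
    by (subst n, rule ln_prod) (auto simp: prime_factors_gt_0_nat)
  also have "\<dots> \<ge> (\<Sum>p\<in>prime_factors n. ln (real p))"
  proof (rule sum_mono)
    fix p assume p: "p \<in> prime_factors n"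
    then have "multiplicity p n \<ge> 1" using assms by (simp add: prime_factors_multiplicity)
    moreover have "real p \<ge> 1" using prime_factors_gt_0_nat[OF p] by simp
    then have "ln (real p) \<ge> 0" by simp
    ultimately have "1 * ln (real p) \<le> real (multiplicity p n) * ln (real p)"
      by (intro mult_right_mono) auto
    then show "ln (real p) \<le> ln (real p ^ multiplicity p n)"
      using \<open>real p \<ge> 1\<close> by (simp add: ln_realpow)
  qed
  finally show ?thesis .
qed

lemma card_multiples:
  assumes "p > (0::nat)"
  shows "card {n \<in> {1..x}. p dvd n} = x div p"
proof -
  have "{n \<in> {1..x}. p dvd n} = (\<lambda>t. p * t) ` {1..x div p}"
  proof (intro set_eqI iffI)
    fix n assume n: "n \<in> {n \<in> {1..x}. p dvd n}"
    then obtain t where t: "n = p * t" by auto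
    then have "t \<in> {1..x div p}"
      using n assms less_eq_div_iff_mult_less_eq[of p t x] by (cases t) (auto simp: mult.commute)
    then show "n \<in> (\<lambda>t. p * t) ` {1..x div p}" using t by blast
  next
    fix n assume "n \<in> (\<lambda>t. p * t) ` {1..x div p}"
    then obtain t where "n = p * t" "t \<in> {1..x div p}" by blast
    then have t: "n = p * t" "1 \<le> t" "t \<le> x div p" by simp_all
    then have "p * t \<le> x" using assms less_eq_div_iff_mult_less_eq[of p t x] by (simp add: mult.commute)
    moreover have "1 * 1 \<le> p * t" using t assms by (intro mult_le_mono) auto
    ultimately show "n \<in> {n \<in> {1..x}. p dvd n}" using t by simp
  qed
  moreover have "inj_on (\<lambda>t. p * t) A" for A using assms by (auto simp: inj_on_def)
  ultimately show ?thesis by (simp add: card_image)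
qed

text \<open>A weak Mertens bound by double counting the pairs of \<open>n \<le> x\<close> and a
  prime \<open>p\<close> dividing \<open>n\<close>. The factor 2 pays for replacing
  \<open>x div p\<close> by \<open>x / p\<close> when \<open>p \<le> x\<close>.\<close>

lemma sum_ln_div_prime_le:
  assumes "x > (0::nat)"
  shows "(\<Sum>p | prime p \<and> p \<le> x. ln (real p) / real p) \<le> 2 * ln (real x)"
proof -
  let ?S = "{p. prime p \<and> p \<le> x}"
  have fin: "finite ?S" by (rule finite_subset[of _ "{..x}"]) auto
  have "real x / 2 * (\<Sum>p\<in>?S. ln (real p) / real p) = (\<Sum>p\<in>?S. real x / (2 * real p) * ln (real p))"
    by (simp add: sum_distrib_left mult_ac)
  also have "\<dots> \<le> (\<Sum>p\<in>?S. real (x div p) * ln (real p))"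
  proof (rule sum_mono, rule mult_right_mono)
    fix p assume p: "p \<in> ?S"
    then have p0: "p > 0" using prime_gt_0_nat by auto
    have "x = p * (x div p) + x mod p" by simp
    moreover have "x mod p < p" using p0 by simp
    moreover have "p * 1 \<le> p * (x div p)" using p p0 by (intro mult_left_mono) (auto simp: Suc_le_eq div_greater_zero_iff)
    ultimately have "x \<le> 2 * (p * (x div p))" by linarith
    then have "real x \<le> 2 * (real p * real (x div p))" by (metis of_nat_le_iff of_nat_mult of_nat_numeral)
    then show "real x / (2 * real p) \<le> real (x div p)" using p0 by (simp add: field_simps)
    show "0 \<le> ln (real p)" using p0 by simp
  qed
  also have "\<dots> = (\<Sum>p\<in>?S. \<Sum>n | n \<in> {1..x} \<and> p dvd n. ln (real p))"
    using card_multiples prime_gt_0_nat by (intro sum.cong) auto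
  also have "\<dots> = (\<Sum>n\<in>{1..x}. \<Sum>p | p \<in> ?S \<and> p dvd n. ln (real p))"
    using fin by (intro sum.swap_restrict) auto
  also have "\<dots> \<le> (\<Sum>n\<in>{1..x}. ln (real x))"
  proof (rule sum_mono)
    fix n assume n: "n \<in> {1..x}"
    then have "p \<le> x" if "p dvd n" for p using dvd_imp_le[OF that] by simp
    then have "{p. p \<in> ?S \<and> p dvd n} = prime_factors n"
      using n by (auto simp: prime_factors_dvd)
    then have "(\<Sum>p | p \<in> ?S \<and> p dvd n. ln (real p)) \<le> ln (real n)"
      using sum_ln_prime_factors_le[of n] n by simp
    also have "\<dots> \<le> ln (real x)" using n by simp
    finally show "(\<Sum>p | p \<in> ?S \<and> p dvd n. ln (real p)) \<le> ln (real x)" .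
  qed
  finally have "real x * (\<Sum>p\<in>?S. ln (real p) / real p) \<le> real x * (2 * ln (real x))" by simp
  then show ?thesis using assms by simp
qed

text \<open>Each ln p is at least ln y, so the bound 2 * ln (y^4) gives 2 * 4 = 8. The exponent 4 is
  the one relating consecutive thresholds \<open>Z j\<close>.\<close>

lemma sum_inverse_primes_le_8:
  assumes "y \<ge> (2::nat)"
  shows "(\<Sum>p | prime p \<and> y < p \<and> p \<le> y ^ 4. 1 / real p) \<le> 8"
proof -
  have ly: "ln (real y) > 0" using assms by simp
  have "ln (real y) * (\<Sum>p | prime p \<and> y < p \<and> p \<le> y ^ 4. 1 / real p)
      \<le> (\<Sum>p | prime p \<and> y < p \<and> p \<le> y ^ 4. ln (real p) / real p)"
    unfolding sum_distrib_left using assms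
    by (intro sum_mono) (auto intro!: divide_right_mono)
  also have "\<dots> \<le> (\<Sum>p | prime p \<and> p \<le> y ^ 4. ln (real p) / real p)"
  proof (rule sum_mono2)
    show "finite {p. prime p \<and> p \<le> y ^ 4}" by (rule finite_subset[of _ "{..y ^ 4}"]) auto
    fix p assume "p \<in> {p. prime p \<and> p \<le> y ^ 4} - {p. prime p \<and> y < p \<and> p \<le> y ^ 4}"
    then have "p \<ge> 1" using prime_ge_1_nat by auto
    then show "0 \<le> ln (real p) / real p" by simp
  qed auto
  also have "\<dots> \<le> 2 * ln (real (y ^ 4))" using assms by (intro sum_ln_div_prime_le) auto
  also have "\<dots> = ln (real y) * 8" using assms by (simp add: ln_realpow)
  finally show ?thesis using ly by (simp only: mult_le_cancel_left_pos)
qed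

text \<open>Each dyadic interval contributes at most 1. This trivial bound is enough for the primes
  up to \<open>L\<close>.\<close>

lemma sum_inverse_upto_power2:
  "(\<Sum>n\<in>{2..2 ^ H}. 1 / real n) \<le> real H"
proof (induction H)
  case 0
  then show ?case by simp
next
  case (Suc H)
  have "{2..2 ^ Suc H} = {2..2 ^ H} \<union> {2 ^ H + 1..2 ^ Suc H :: nat}" (is "_ = ?A \<union> ?B")
    by (cases "H = 0") (auto simp: self_le_power intro: order.trans[of 2 "2 ^ H"])
  then have "(\<Sum>n\<in>{2..2 ^ Suc H}. 1 / real n) = (\<Sum>n\<in>?A. 1 / real n) + (\<Sum>n\<in>?B. 1 / real n)"
    by (simp only:) (rule sum.union_disjoint, auto)
  also have "(\<Sum>n\<in>?B. 1 / real n) \<le> (\<Sum>n\<in>?B. 1 / 2 ^ H)"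
  proof (rule sum_mono)
    fix n :: nat assume "n \<in> ?B"
    then have "real (2 ^ H) \<le> real n" by (subst of_nat_le_iff) simp
    then show "1 / real n \<le> 1 / 2 ^ H" 
      by (simp add: frac_le)
  qed
  also have "\<dots> = 1" by simp
  finally show ?case using Suc by simp
qed

section \<open>Integers with a prescribed number of prime factors\<close>

lemma Omega_eq_sum_multiplicity:
  assumes "finite S" "prime_factors e \<subseteq> S" "\<And>p. p \<in> S \<Longrightarrow> prime p"
  shows "Omega e = (\<Sum>p\<in>S. multiplicity p e)"
proof -
  have "Omega e = (\<Sum>p\<in>prime_factors e. count (prime_factorization e) p)"
    by (simp add: Omega_def size_multiset_overloaded_eq)
  also have "\<dots> = (\<Sum>p\<in>S. count (prime_factorization e) p)"
    using assms by (intro sum.mono_neutral_left) (auto simp: not_in_iff)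
  also have "\<dots> = (\<Sum>p\<in>S. multiplicity p e)"
    using assms by (intro sum.cong) (auto simp: count_prime_factorization_prime)
  finally show ?thesis .
qed

lemma prod_prime_powers_superset:
  assumes "finite S" "prime_factors e \<subseteq> S" "\<And>p. p \<in> S \<Longrightarrow> prime p" "e > (0::nat)"
  shows "e = (\<Prod>p\<in>S. p ^ multiplicity p e)"
proof -
  have "e = (\<Prod>p\<in>prime_factors e. p ^ multiplicity p e)"
    using prod_prime_factors[of e] assms(4) by simp
  also have "\<dots> = (\<Prod>p\<in>S. p ^ multiplicity p e)"
  proof (rule prod.mono_neutral_left[OF assms(1,2)], rule ballI)
    fix p assume "p \<in> S - prime_factors e"
    then have "multiplicity p e = 0" using assms(3)[of p] assms(4) by (auto simp: prime_factors_multiplicity)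
    then show "p ^ multiplicity p e = 1" by simp
  qed
  finally show ?thesis .
qed

definition Omega_level :: "nat set \<Rightarrow> nat \<Rightarrow> nat set" where
  "Omega_level S r = {e. e > 0 \<and> prime_factors e \<subseteq> S \<and> Omega e = r}"

lemma inj_on_exponents:
  assumes "finite S" "\<And>p. p \<in> S \<Longrightarrow> prime p"
  shows "inj_on (\<lambda>e. \<lambda>p\<in>S. multiplicity p e) (Omega_level S r)"
proof (rule inj_onI)
  fix e e' assume e: "e \<in> Omega_level S r" "e' \<in> Omega_level S r"
    and eq: "(\<lambda>p\<in>S. multiplicity p e) = (\<lambda>p\<in>S. multiplicity p e')"
  have "e = (\<Prod>p\<in>S. p ^ multiplicity p e)" "e' = (\<Prod>p\<in>S. p ^ multiplicity p e')"
    using e assms by (auto simp: Omega_level_def intro!: prod_prime_powers_superset)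
  moreover have "(\<Prod>p\<in>S. p ^ multiplicity p e) = (\<Prod>p\<in>S. p ^ multiplicity p e')"
    using eq by (intro prod.cong refl) (metis restrict_apply')
  ultimately show "e = e'" by simp
qed

lemma exponents_in_PiE:
  assumes "finite S" "\<And>p. p \<in> S \<Longrightarrow> prime p" "e \<in> Omega_level S r"
  shows "(\<lambda>p\<in>S. multiplicity p e) \<in> (\<Pi>\<^sub>E p\<in>S. {..r})"
proof -
  have "Omega e = (\<Sum>p\<in>S. multiplicity p e)"
    using assms by (intro Omega_eq_sum_multiplicity) (auto simp: Omega_level_def)
  then have "multiplicity p e \<le> r" if "p \<in> S" for p
    using member_le_sum[of p S "\<lambda>p. multiplicity p e"] assms that by (auto simp: Omega_level_def)
  then show ?thesis by auto
qed

lemma finite_Omega_level: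
  assumes "finite S" "\<And>p. p \<in> S \<Longrightarrow> prime p"
  shows "finite (Omega_level S r)"
proof (rule inj_on_finite[OF inj_on_exponents[OF assms]])
  show "(\<lambda>e. \<lambda>p\<in>S. multiplicity p e) ` Omega_level S r \<subseteq> (\<Pi>\<^sub>E p\<in>S. {..r})"
    using exponents_in_PiE[OF assms] by blast
qed (use assms in \<open>auto intro: finite_PiE\<close>)

text \<open>The term \<open>8 * z ^ Suc r\<close> majorizes the omitted tail, since 1 / (1 - z) is
  at most 4; including it makes the induction close.\<close>

lemma truncated_geometric_le:
  fixes z :: real
  assumes "0 \<le> z" "z \<le> 3 / 4"
  shows "(\<Sum>a\<le>r. if a = 0 then 1 else 2 * z ^ a) + 8 * z ^ Suc r \<le> 1 + 8 * z"
proof (induction r)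
  case 0
  then show ?case by simp
next
  case (Suc r)
  have "z * z ^ Suc r \<le> 3/4 * z ^ Suc r" using assms by (intro mult_right_mono) auto
  then show ?case using Suc by simp
qed

text \<open>Rankin's trick with the weight \<open>(3/2)\<^sup>\<Omega>\<close>; the base must stay below the prime \<open>2\<close>.\<close>

lemma sum_Omega_level_le:
  assumes "finite S" "\<And>p. p \<in> S \<Longrightarrow> prime p"
  shows "(\<Sum>e\<in>Omega_level S r. 2 ^ card (prime_factors e) / real e) \<le> (2/3) ^ r * exp (12 * (\<Sum>p\<in>S. 1 / real p))"
proof -
  \<comment> \<open>The local factor at \<open>p\<close> of 2^omega(e) * (3/2)^Omega(e) / e.\<close>
  define \<phi> where "\<phi> p a = (if a = 0 then 1 else 2 * (3 / 2 / real p) ^ a)" for p a :: nat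
  have \<phi>0: "\<phi> p a \<ge> 0" for p a by (simp add: \<phi>_def)
  have term_eq: "2 ^ card (prime_factors e) / real e = (2/3) ^ r * (\<Prod>p\<in>S. \<phi> p (multiplicity p e))"
    if "e \<in> Omega_level S r" for e
  proof -
    have e: "e > 0" "prime_factors e \<subseteq> S" "Omega e = r" using that by (auto simp: Omega_level_def)
    have pf: "p \<in> prime_factors e \<longleftrightarrow> multiplicity p e \<noteq> 0" if "p \<in> S" for p
      using assms(2)[OF that] e(1) by (auto simp: prime_factors_multiplicity)
    have "(\<Prod>p\<in>S. \<phi> p (multiplicity p e))
        = (\<Prod>p\<in>S. (if p \<in> prime_factors e then 2 else 1) * ((3/2) ^ multiplicity p e / real p ^ multiplicity p e))"
      using pf by (intro prod.cong) (auto simp: \<phi>_def power_divide)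
    also have "\<dots> = (\<Prod>p\<in>S. if p \<in> prime_factors e then 2 else 1) * ((\<Prod>p\<in>S. (3/2) ^ multiplicity p e) / (\<Prod>p\<in>S. real p ^ multiplicity p e))"
      by (simp add: prod.distrib prod_dividef)
    also have "(\<Prod>p\<in>S. if p \<in> prime_factors e then 2 else (1::real)) = 2 ^ card (prime_factors e)"
      using assms(1) e(2) by (simp add: prod.If_cases Int_absorb1)
    also have "(\<Prod>p\<in>S. (3/2::real) ^ multiplicity p e) = (3/2) ^ r"
      using Omega_eq_sum_multiplicity[OF assms(1) e(2) assms(2)] e(3) by (simp flip: power_sum)
    also have "(\<Prod>p\<in>S. real p ^ multiplicity p e) = real e"
      using arg_cong[OF prod_prime_powers_superset[OF assms(1) e(2) assms(2) e(1)], of real] by simp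
    finally have "(2/3) ^ r * (\<Prod>p\<in>S. \<phi> p (multiplicity p e)) = ((2/3) ^ r * (3/2) ^ r) * (2 ^ card (prime_factors e) / real e)"
      by simp
    also have "(2/3::real) ^ r * (3/2) ^ r = 1" by (simp flip: power_mult_distrib)
    finally show ?thesis by simp
  qed
  have "(\<Sum>e\<in>Omega_level S r. 2 ^ card (prime_factors e) / real e)
      = (2/3) ^ r * (\<Sum>e\<in>Omega_level S r. \<Prod>p\<in>S. \<phi> p ((\<lambda>p\<in>S. multiplicity p e) p))"
    unfolding sum_distrib_left using term_eq by (intro sum.cong refl) (simp cong: prod.cong)
  also have "(\<Sum>e\<in>Omega_level S r. \<Prod>p\<in>S. \<phi> p ((\<lambda>p\<in>S. multiplicity p e) p))
      = (\<Sum>g\<in>(\<lambda>e. \<lambda>p\<in>S. multiplicity p e) ` Omega_level S r. \<Prod>p\<in>S. \<phi> p (g p))"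
    by (simp only: sum.reindex[OF inj_on_exponents[OF assms]] o_def)
  \<comment> \<open>Dropping the constraint that the exponents sum to \<open>r\<close> turns the sum
    into an Euler product.\<close>
  also have "\<dots> \<le> (\<Sum>g\<in>(\<Pi>\<^sub>E p\<in>S. {..r}). \<Prod>p\<in>S. \<phi> p (g p))"
  proof (rule sum_mono2)
    show "(\<lambda>e. \<lambda>p\<in>S. multiplicity p e) ` Omega_level S r \<subseteq> (\<Pi>\<^sub>E p\<in>S. {..r})"
      using exponents_in_PiE[OF assms] by blast
  qed (use assms \<phi>0 in \<open>auto intro: finite_PiE prod_nonneg\<close>)
  also have "\<dots> = (\<Prod>p\<in>S. \<Sum>a\<le>r. \<phi> p a)"
    using assms by (intro prod_sum_PiE[symmetric]) auto
  also have "\<dots> \<le> (\<Prod>p\<in>S. exp (12 * (1 / real p)))"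
  proof (rule prod_mono, intro conjI)
    fix p assume "p \<in> S"
    then have p2: "p \<ge> 2" using assms prime_ge_2_nat by blast
    show "0 \<le> (\<Sum>a\<le>r. \<phi> p a)" using \<phi>0 by (intro sum_nonneg) auto
    have z: "0 \<le> 3 / 2 / real p" "3 / 2 / real p \<le> 3 / 4" using p2 by (auto simp: field_simps)
    have "0 \<le> 8 * (3 / 2 / real p) ^ Suc r" by simp
    then have "(\<Sum>a\<le>r. \<phi> p a) \<le> 1 + 8 * (3 / 2 / real p)"
      unfolding \<phi>_def using truncated_geometric_le[OF z, of r] by linarith
    also have "\<dots> = 1 + 12 * (1 / real p)" by simp
    also have "\<dots> \<le> exp (12 * (1 / real p))" by (rule exp_ge_add_one_self)
    finally show "(\<Sum>a\<le>r. \<phi> p a) \<le> exp (12 * (1 / real p))" .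
  qed
  also have "\<dots> = exp (12 * (\<Sum>p\<in>S. 1 / real p))"
    using assms by (simp add: exp_sum sum_distrib_left)
  finally show ?thesis by simp
qed

lemma prod_mset_power_le:
  assumes "\<And>p. p \<in># M \<Longrightarrow> p ^ c \<le> (Y::nat)"
  shows "(prod_mset M) ^ c \<le> Y ^ size M"
  using assms by (induction M) (auto simp: power_mult_distrib intro: mult_mono)

lemma prod_mset_power_ge:
  assumes "\<And>p. p \<in># M \<Longrightarrow> Y \<le> (p::nat) ^ c"
  shows "Y ^ size M \<le> (prod_mset M) ^ c"
  using assms by (induction M) (auto simp: power_mult_distrib intro: mult_mono)

lemma power2_Omega_le:
  assumes "n > 0"
  shows "2 ^ Omega n \<le> n"
proof -
  have "2 ^ size (prime_factorization n) \<le> prod_mset (prime_factorization n) ^ 1"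
    by (rule prod_mset_power_ge) (auto dest: prime_ge_2_nat in_prime_factors_imp_prime)
  then show ?thesis using assms by (simp add: Omega_def prod_mset_prime_factorization)
qed

lemma Omega_le_log:
  assumes "n > 0"
  shows "real (Omega n) \<le> log 2 (real n)"
proof -
  have "real (2 ^ Omega n) \<le> real n" using power2_Omega_le[OF assms] by (subst of_nat_le_iff)
  then have "2 powr real (Omega n) \<le> real n" by (simp add: powr_realpow)
  then show ?thesis using assms by (simp add: le_log_iff)
qed

lemma Omega_mult: "a > 0 \<Longrightarrow> b > 0 \<Longrightarrow> Omega (a * b) = Omega a + Omega b"
  by (simp add: Omega_def prime_factorization_mult)

lemma omega_le_Omega: "omega n \<le> Omega n"
  unfolding omega_def Omega_def by (metis size_mset_set finite_set_mset mset_set_set_mset_msubset size_mset_mono)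

lemma ex_submultiset_size:
  assumes "r \<le> size M"
  shows "\<exists>N. N \<subseteq># M \<and> size N = r"
proof -
  obtain xs where xs: "mset xs = M" using ex_mset by blast
  have "mset (take r xs) + mset (drop r xs) = M" using xs by (simp flip: mset_append)
  then have "mset (take r xs) \<subseteq># M" by (metis mset_subset_eq_add_left)
  moreover have "size (mset (take r xs)) = r" using assms xs by auto
  ultimately show ?thesis by blast
qed

text \<open>Converts an excess of prime factors into a divisibility that the sieve can count: at
  least \<open>r\<close> of the prime factors, with multiplicity, lie in \<open>S\<close>, and any
  \<open>r\<close> of them multiply to a suitable \<open>e\<close>.\<close>

lemma ex_Omega_level_dvd:
  assumes "n > 0" "size (filter_mset (\<lambda>p. p \<notin> S) (prime_factorization n)) \<le> t" "Omega n \<ge> t + r"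
  shows "\<exists>e\<in>Omega_level S r. e dvd n"
proof -
  let ?M = "filter_mset (\<lambda>p. p \<in> S) (prime_factorization n)"
  have "prime_factorization n = ?M + filter_mset (\<lambda>p. p \<notin> S) (prime_factorization n)"
    by (rule multiset_partition)
  then have "Omega n = size ?M + size (filter_mset (\<lambda>p. p \<notin> S) (prime_factorization n))"
    unfolding Omega_def by (metis size_union)
  then have "r \<le> size ?M" using assms by linarith
  then obtain M where M: "M \<subseteq># ?M" "size M = r" using ex_submultiset_size by blast
  then have sub: "M \<subseteq># prime_factorization n" by (meson multiset_filter_subset subset_mset.order_trans)
  have pr: "prime p" if "p \<in># M" for p
    using mset_subset_eqD[OF sub that] by (rule in_prime_factors_imp_prime)
  define e where "e = prod_mset M"
  have pfe: "prime_factorization e = M"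
    unfolding e_def by (rule prime_factorization_prod_mset_primes) (rule pr)
  have "e > 0" unfolding e_def using pr prime_gt_0_nat by (metis gr0I prod_mset_zero_iff not_prime_0)
  moreover have "set_mset M \<subseteq> S" using M(1) by (auto dest: mset_subset_eqD)
  ultimately have "e \<in> Omega_level S r" using pfe M(2) by (auto simp: Omega_level_def Omega_def)
  moreover have "e dvd n"
  proof -
    have "prod_mset M dvd prod_mset (prime_factorization n)" using sub by (rule prod_mset_subset_imp_dvd)
    then show ?thesis using assms(1) by (simp add: e_def prod_mset_prime_factorization)
  qed
  ultimately show ?thesis by blast
qed

section \<open>Exponential inequalities and the tail of one sieve block\<close>

lemma power_div_fact_le_exp:
  fixes x :: real
  assumes "x \<ge> 0"
  shows "x ^ n / fact n \<le> exp x"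
proof -
  have s: "(\<lambda>n. x ^ n / fact n) sums exp x" using exp_converges[of x] by (simp add: divide_inverse mult.commute)
  have "(\<Sum>i\<in>{n}. x ^ i / fact i) \<le> (\<Sum>i. x ^ i / fact i)"
    using s assms by (intro sum_le_suminf) (auto simp: sums_iff)
  then show ?thesis using s by (simp add: sums_iff)
qed

lemma exp_uminus_double_le:
  fixes x :: real
  assumes "0 \<le> x" "x \<le> 1 / 2"
  shows "exp (- 2 * x) \<le> 1 - x"
proof -
  have "x * (2 * x) \<le> x * 1" using assms by (intro mult_left_mono) auto
  then have "1 \<le> (1 - x) * (1 + 2 * x)" by (simp add: algebra_simps)
  also have "\<dots> \<le> (1 - x) * exp (2 * x)" using assms exp_ge_add_one_self[of "2 * x"] by (intro mult_left_mono) auto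
  finally have "exp (- (2 * x)) * 1 \<le> exp (- (2 * x)) * ((1 - x) * exp (2 * x))" by (intro mult_left_mono) auto
  also have "\<dots> = 1 - x" by (simp add: exp_minus)
  finally show ?thesis by simp
qed

lemma prod_one_minus_ge:
  assumes "\<And>p. p \<in> P \<Longrightarrow> 0 \<le> x p \<and> x p \<le> (1 / 2 :: real)" "(\<Sum>p\<in>P. x p) \<le> s" "finite P"
  shows "exp (- 2 * s) \<le> (\<Prod>p\<in>P. 1 - x p)"
proof -
  have "exp (- 2 * s) \<le> exp (- 2 * (\<Sum>p\<in>P. x p))" using assms by simp
  also have "\<dots> = (\<Prod>p\<in>P. exp (- 2 * x p))" using assms(3) by (simp add: sum_distrib_left flip: exp_sum sum_negf)
  also have "\<dots> \<le> (\<Prod>p\<in>P. 1 - x p)"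
    using assms by (intro prod_mono conjI exp_uminus_double_le) auto
  finally show ?thesis .
qed

text \<open>With s the sum of the \<open>x p\<close> and R the degree, s^R / R! is at most exp (9s -
  2R), because 1/9 is at most exp (-2). The constant 46 comes from 2 * 46 = 72 + 16 + 4: 72K bounds
  9s, 16K pays for the product on the right, and 4K is the gain.\<close>

lemma sympoly_tail_le:
  assumes "finite P" "\<And>p. p \<in> P \<Longrightarrow> 0 \<le> x p \<and> x p \<le> 1 / 2" "(\<Sum>p\<in>P. x p) \<le> 8 * real K"
  shows "sympoly (only_at (Suc (46 * K))) x P \<le> exp (- 4 * real K) * (\<Prod>p\<in>P. 1 - x p)"
proof -
  define s where "s = (\<Sum>p\<in>P. x p)"
  define R where "R = Suc (46 * K)"
  have s: "0 \<le> s" "s \<le> 8 * real K" using assms by (auto simp: s_def intro: sum_nonneg)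
  have "sympoly (only_at R) x P \<le> s ^ R / fact R"
    unfolding s_def using assms by (intro sympoly_only_at_le) auto
  also have "\<dots> = (9 * s) ^ R / fact R * (1 / 9) ^ R" by (simp add: power_mult_distrib power_divide)
  also have "\<dots> \<le> exp (9 * s) * exp (- 2) ^ R"
  proof (rule mult_mono)
    show "(9 * s) ^ R / fact R \<le> exp (9 * s)" using s by (intro power_div_fact_le_exp) auto
    have "exp (2::real) = exp 1 * exp 1" by (simp flip: exp_add)
    also have "\<dots> \<le> 3 * 3" using exp_le by (intro mult_mono) auto
    finally have "1 / 9 \<le> exp (- 2 :: real)" by (simp add: exp_minus field_simps)
    then show "(1 / 9) ^ R \<le> exp (- 2 :: real) ^ R" by (intro power_mono) auto
  qed auto
  also have "\<dots> = exp (9 * s - 2 * real R)" by (simp add: exp_diff exp_minus power_inverse divide_inverse flip: exp_of_nat_mult)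
  also have "\<dots> \<le> exp (- 4 * real K + (- 2 * (8 * real K)))" using s by (simp add: R_def)
  also have "\<dots> = exp (- 4 * real K) * exp (- 2 * (8 * real K))" by (rule exp_add)
  also have "\<dots> \<le> exp (- 4 * real K) * (\<Prod>p\<in>P. 1 - x p)"
    using assms by (intro mult_left_mono prod_one_minus_ge) auto
  finally show ?thesis unfolding R_def .
qed

lemma exp_minus_power2_le: "exp (- 4 * real (2 ^ j)) \<le> (1 / 2) ^ (j + 2)"
proof -
  have "j + 1 \<le> 2 ^ j" using less_exp[of j] by linarith
  then have "real (j + 1) \<le> real (2 ^ j)" by (subst of_nat_le_iff)
  then have "exp (- 4 * real (2 ^ j)) \<le> exp (real (j + 2) * (- 1))" by simp
  also have "\<dots> = exp (- 1) ^ (j + 2)" by (rule exp_of_nat_mult)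
  also have "\<dots> \<le> (1 / 2) ^ (j + 2)"
    using exp_ge_add_one_self[of 1] by (intro power_mono) (auto simp: exp_minus field_simps)
  finally show ?thesis .
qed

lemma sum_half_powers: "(\<Sum>j<n. (1 / 2 :: real) ^ (j + 2)) \<le> 1 / 2"
proof -
  have "(\<Sum>j<n. (1 / 2 :: real) ^ (j + 2)) = 1 / 2 - (1 / 2) ^ (n + 1)"
    by (induction n) (auto simp: field_simps)
  then show ?thesis by simp
qed

text \<open>Counting the last power once more makes the geometric sum close up exactly, without
  subtraction.\<close>

lemma sum_descending_powers2:
  assumes "a < n" "n \<le> M"
  shows "(\<Sum>j\<in>{Suc a..<n}. 2 ^ (M - j)) + 2 ^ (M - (n - 1)) \<le> (2 ^ (M - a) :: nat)"
proof -
  have "Suc a \<le> n" using assms by simp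
  then show ?thesis using assms
  proof (induction n rule: dec_induct)
    case base
    then show ?case by simp
  next
    case (step n)
    have "M - (n - 1) = Suc (M - n)" using step by linarith
    then show ?case using step by simp
  qed
qed

section \<open>Dyadic levels of \<open>k\<close> and linear congruences\<close>

definition dyadic_level :: "nat \<Rightarrow> nat" where "dyadic_level k = (LEAST i. k \<le> 2 ^ i)"

lemma le_power_level: "k \<le> 2 ^ dyadic_level k"
  unfolding dyadic_level_def by (rule LeastI[of _ k]) (simp add: less_imp_le)

lemma dyadic_level_pos:
  assumes "2 \<le> k"
  shows "0 < dyadic_level k"
  using le_power_level[of k] assms by (cases "dyadic_level k") auto

text \<open>The level is log 2 k rounded up; doubling absorbs the rounding because log 2 k is at
  least 1.\<close>

lemma dyadic_level_le_log:
  assumes "2 \<le> k"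
  shows "real (dyadic_level k) \<le> 2 * log 2 (real k)"
proof -
  have "\<not> k \<le> 2 ^ (dyadic_level k - 1)"
    using dyadic_level_pos[OF assms] not_less_Least[of "dyadic_level k - 1" "\<lambda>i. k \<le> 2 ^ i"] unfolding dyadic_level_def by simp
  then have "real (2 ^ (dyadic_level k - 1)) \<le> real k" by (subst of_nat_le_iff) simp
  then have "2 powr real (dyadic_level k - 1) \<le> real k" by (simp add: powr_realpow)
  then have "real (dyadic_level k - 1) \<le> log 2 (real k)" using assms by (simp add: le_log_iff)
  moreover have "1 \<le> log 2 (real k)" using assms by (simp add: le_log_iff)
  ultimately show ?thesis using dyadic_level_pos[OF assms] by (simp add: of_nat_diff)
qed

text \<open>If some solution exists, a common divisor of \<open>u\<close> and \<open>e\<close> also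
  divides \<open>v\<close>, so \<open>u\<close> is invertible modulo \<open>e\<close> and the class
  is unique; otherwise any \<open>a\<close> will do. The condition \<open>v < u * m\<close> guards
  the truncated subtraction.\<close>

lemma linear_residue_class:
  fixes u v e :: nat
  assumes "coprime u v"
  shows "\<exists>a. \<forall>m. v < u * m \<longrightarrow> e dvd u * m - v \<longrightarrow> m mod e = a mod e"
proof (cases "\<exists>m. v < u * m \<and> e dvd u * m - v")
  case True
  then obtain a where a: "v < u * a" "e dvd u * a - v" by blast
  have cop: "coprime u e"
  proof (rule coprimeI)
    fix d assume d: "d dvd u" "d dvd e"
    then have "d dvd u * a - v" "d dvd u * a" using a(2) dvd_trans by auto
    then have "d dvd v" using a(1) by (metis dvd_diffD1 less_imp_le)
    then show "is_unit d" using assms d(1) coprime_common_divisor by blast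
  qed
  have "m mod e = a mod e" if m: "v < u * m" "e dvd u * m - v" for m
  proof -
    have "[u * m = v] (mod e)" "[u * a = v] (mod e)"
      using m a by (auto simp: cong_altdef_nat less_imp_le)
    then have "[u * m = u * a] (mod e)" by (metis cong_sym cong_trans)
    then have "[m = a] (mod e)" using cop cong_mult_lcancel_nat by blast
    then show ?thesis by (simp add: cong_def)
  qed
  then show ?thesis by blast
qed auto

lemma card_solutions_le_1:
  fixes p W k :: nat
  assumes "coprime W p"
  shows "card {c. c < p \<and> [W * c = k] (mod p)} \<le> 1"
proof -
  have "c = c'" if "c < p" "c' < p" "[W * c = k] (mod p)" "[W * c' = k] (mod p)" for c c'
  proof -
    have "[W * c = W * c'] (mod p)" using that(3,4) by (metis cong_sym cong_trans)
    then have "[c = c'] (mod p)" using assms cong_mult_lcancel_nat by blast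
    then show ?thesis using that(1,2) by (simp add: cong_def)
  qed
  then show ?thesis by (simp add: card_le_Suc0_iff_eq)
qed

text \<open>A discrete intermediate value argument; it finds the block containing a given
  prime.\<close>

lemma ex_between_antimono:
  fixes Z :: "nat \<Rightarrow> nat"
  assumes "Z b < p" "p \<le> Z a" "a \<le> b"
  shows "\<exists>j. a \<le> j \<and> j < b \<and> Z (Suc j) < p \<and> p \<le> Z j"
  using assms(3,1)
proof (induction b rule: dec_induct)
  case base
  then show ?case using assms(2) by simp
next
  case (step b)
  show ?case
  proof (cases "Z b < p")
    case True
    then show ?thesis using step.IH less_SucI by blast
  next
    case False
    then show ?thesis using step by (intro exI[of _ b]) auto
  qed
qed

section \<open>The choice of parameters\<close>

text \<open>Any multiple of \<open>3\<close> satisfying \<open>depth_decay\<close> would do; there \<open>1188 = 12 * 99\<close> is the exponent produced by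
  \<open>sum_Omega_level_le\<close> and \<open>sum_inverse_mid_primes\<close>.\<close>

definition depth :: nat where "depth = 3 * 1194"

lemma depth_pos: "depth > 0" by (simp add: depth_def)

text \<open>From e \<le> 3 \<le> (3/2)^3 follows (2/3)^depth \<le> exp (-1194). The 6 units beyond
  1188 give 1/64, as e^6 is at least 2^6. The base 64 turns a bound in the dyadic level of
  \<open>k\<close> into k^(-6).\<close>

lemma depth_decay: "(2 / 3) ^ depth * exp 1188 \<le> (1 / 64 :: real)"
proof -
  have "exp 1194 = (exp 1 :: real) ^ 1194" using exp_of_nat_mult[of 1194 "1::real"] by simp
  also have "\<dots> \<le> ((3 / 2) ^ 3) ^ 1194"
  proof (rule power_mono)
    have "exp 1 \<le> (3::real)" by (rule exp_le)
    also have "(3::real) \<le> (3 / 2) ^ 3" by (simp add: power3_eq_cube)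
    finally show "exp 1 \<le> (3 / 2 :: real) ^ 3" .
  qed simp
  also have "\<dots> = (3 / 2) ^ depth" unfolding depth_def by (rule power_mult[symmetric])
  finally have "(2 / 3) ^ depth * exp 1194 \<le> (2 / 3) ^ depth * (3 / 2 :: real) ^ depth" by (intro mult_left_mono) auto
  also have "\<dots> = (2 / 3 * (3 / 2)) ^ depth" by (rule power_mult_distrib[symmetric])
  also have "\<dots> = 1" by simp
  finally have 1: "(2 / 3) ^ depth * exp 1194 \<le> (1::real)" .
  have "(2::real) ^ 6 \<le> exp 1 ^ 6" using exp_ge_add_one_self[of 1] by (intro power_mono) auto
  also have "\<dots> = exp 6" using exp_of_nat_mult[of 6 "1::real"] by simp
  finally have "64 \<le> exp (6::real)" by simp
  then have "(2 / 3) ^ depth * exp 1188 * 64 \<le> (2 / 3) ^ depth * exp 1188 * exp (6::real)"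
    by (intro mult_left_mono) auto
  also have "\<dots> = (2 / 3) ^ depth * exp 1194" by (simp add: mult.assoc flip: exp_add)
  finally have "(2 / 3) ^ depth * exp 1188 * 64 \<le> (1::real)" using 1 by linarith
  then show ?thesis by simp
qed

text \<open>The integers \<open>n = W * m\<close> with \<open>m \<le> X\<close> are sieved. Since \<open>k * fact L\<close> divides \<open>W\<close> for \<open>k \<le> L\<close>,
  the primes up to \<open>L\<close> occur in \<open>n - k\<close> exactly as in \<open>k\<close>. The block \<open>P j\<close> consists of the primes in
  \<open>(X\<^bsup>1/4^(j+1)\<^esup>, X\<^bsup>1/4^j\<^esup>]\<close>, and \<open>R p\<close> collects the classes of \<open>m\<close> for which \<open>p \<in> P j\<close> divides some
  \<open>n - k\<close> with \<open>2 \<le> k \<le> 2 ^ j\<close>; the slow growth of \<open>2 ^ j\<close> keeps the level of the sieve below \<open>Y = X\<^bsup>1/10\<^esup>\<close>.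
  The factor \<open>10\<close> in \<open>H\<close> makes \<open>Y\<close> an integer.\<close>

locale scales =
  fixes h :: nat
  assumes h_ge_2: "h \<ge> 2"
begin

definition H :: nat where "H = 10 * h"
definition Y :: nat where "Y = 2 ^ (h * 4 ^ H)"
definition X :: nat where "X = Y ^ 10"
definition L :: nat where "L = 2 ^ H"
definition W :: nat where "W = fact L ^ 2"
definition Z :: "nat \<Rightarrow> nat" where "Z j = 2 ^ (H * 4 ^ (H - j))"
definition P :: "nat \<Rightarrow> nat set" where "P j = {p. prime p \<and> Z (Suc j) < p \<and> p \<le> Z j}"
text \<open>The start 11 keeps the level below \<open>Y\<close>, where 940 \<le> 2 ^ 10 is needed.
  The primes above \<open>Z 11\<close> remain unsieved, but their reciprocals have a bounded
  sum.\<close>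

definition J :: "nat set" where "J = {11..<H}"
definition R :: "nat \<Rightarrow> nat set" where
  "R p = {c. c < p \<and> (\<exists>j\<in>J. p \<in> P j \<and> (\<exists>k\<in>{2..2 ^ j}. [W * c = k] (mod p)))}"

lemma H_ge: "H \<ge> 20" using h_ge_2 by (simp add: H_def)

lemma Y_pos: "Y > 0" by (simp add: Y_def)

lemma X_eq_Z0: "X = Z 0"
proof -
  have "X = 2 ^ (h * 4 ^ H * 10)" unfolding X_def Y_def by (rule power_mult[symmetric])
  also have "h * 4 ^ H * 10 = H * 4 ^ H" by (simp add: H_def)
  finally show ?thesis by (simp add: Z_def)
qed

text \<open>The blocks end exactly at \<open>L\<close>, where the divisibility properties of
  \<open>W\<close> take over, so no gap is left between the two.\<close>

lemma Z_H: "Z H = L" by (simp add: Z_def L_def)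

lemma Z_antimono: "i \<le> j \<Longrightarrow> Z j \<le> Z i"
  unfolding Z_def by (intro power_increasing mult_le_mono) auto

lemma Z_ge_L: "L \<le> Z j"
  unfolding Z_def L_def by (intro power_increasing) auto

lemma L_ge_2: "L \<ge> 2"
  using H_ge self_le_power[of 2 H] by (simp add: L_def)

lemma Z_Suc:
  assumes "j < H"
  shows "Z j = Z (Suc j) ^ 4"
proof -
  have "Z (Suc j) ^ 4 = 2 ^ (H * 4 ^ (H - Suc j) * 4)" unfolding Z_def by (rule power_mult[symmetric])
  also have "H * 4 ^ (H - Suc j) * 4 = H * 4 ^ Suc (H - Suc j)" by simp
  also have "Suc (H - Suc j) = H - j" using assms by simp
  finally show ?thesis by (simp only: Z_def)
qed

lemma finite_P: "finite (P j)"
  by (rule finite_subset[of _ "{..Z j}"]) (auto simp: P_def)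

lemma P_disjoint: "i \<noteq> j \<Longrightarrow> P i \<inter> P j = {}"
proof (induction i j rule: linorder_wlog)
  case (le i j)
  then have "Z j \<le> Z (Suc i)" by (intro Z_antimono) auto
  then show ?case by (auto simp: P_def)
qed (auto simp: Int_commute)

lemma prime_gt_L_coprime_W: "prime p \<Longrightarrow> L < p \<Longrightarrow> coprime W p"
proof -
  assume p: "prime p" "L < p"
  then have "\<not> p dvd W" unfolding W_def using prime_dvd_power[of p "fact L" 2] by (auto simp: prime_dvd_fact_iff)
  then show ?thesis using p prime_imp_coprime coprime_commute by blast
qed

lemma P_gt_L: "p \<in> P j \<Longrightarrow> L < p"
  using Z_ge_L[of "Suc j"] by (auto simp: P_def)

lemma card_R_le:
  assumes "j \<in> J" "p \<in> P j"
  shows "card (R p) \<le> 2 ^ j"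
proof -
  have cop: "coprime W p" using assms P_gt_L prime_gt_L_coprime_W by (auto simp: P_def)
  have "R p \<subseteq> (\<Union>k\<in>{2..2 ^ j}. {c. c < p \<and> [W * c = k] (mod p)})"
  proof
    fix c assume "c \<in> R p"
    then obtain j' k where c: "c < p" "p \<in> P j'" "k \<in> {2..2 ^ j'}" "[W * c = k] (mod p)"
      unfolding R_def by blast
    then have "j' = j" using assms(2) P_disjoint by blast
    then show "c \<in> (\<Union>k\<in>{2..2 ^ j}. {c. c < p \<and> [W * c = k] (mod p)})" using c by blast
  qed
  then have "card (R p) \<le> card (\<Union>k\<in>{2..2 ^ j}. {c. c < p \<and> [W * c = k] (mod p)})"
    by (intro card_mono) auto
  also have "\<dots> \<le> (\<Sum>k\<in>{2..2 ^ j}. card {c. c < p \<and> [W * c = k] (mod p)})"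
    by (rule card_UN_le) auto
  also have "\<dots> \<le> (\<Sum>k\<in>{2..2 ^ j :: nat}. 1)" using card_solutions_le_1[OF cop] by (intro sum_mono) auto
  also have "\<dots> \<le> 2 ^ j" by simp
  finally show ?thesis .
qed

lemma sum_inverse_P_le: "j < H \<Longrightarrow> (\<Sum>p\<in>P j. 1 / real p) \<le> 8"
  unfolding P_def using sum_inverse_primes_le_8[of "Z (Suc j)"] Z_ge_L[of "Suc j"] L_ge_2 Z_Suc by simp

lemma dens_sum_le:
  assumes "j \<in> J"
  shows "(\<Sum>p\<in>P j. real (card (R p)) / real p) \<le> 8 * real (2 ^ j)"
proof -
  have "(\<Sum>p\<in>P j. real (card (R p)) / real p) \<le> (\<Sum>p\<in>P j. real (2 ^ j) * (1 / real p))"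
  proof (rule sum_mono)
    fix p assume "p \<in> P j"
    then have "real (card (R p)) \<le> real (2 ^ j)" using card_R_le[OF assms] by (subst of_nat_le_iff)
    then show "real (card (R p)) / real p \<le> real (2 ^ j) * (1 / real p)" by (simp add: divide_right_mono)
  qed
  also have "\<dots> = real (2 ^ j) * (\<Sum>p\<in>P j. 1 / real p)" by (simp add: sum_distrib_left)
  also have "\<dots> \<le> real (2 ^ j) * 8" using assms by (intro mult_left_mono sum_inverse_P_le) (auto simp: J_def)
  finally show ?thesis by simp
qed

lemma two_card_R_le:
  assumes "j \<in> J" "p \<in> P j"
  shows "2 * card (R p) \<le> p"
proof -
  have "2 * card (R p) \<le> 2 ^ Suc j" using card_R_le[OF assms] by simp
  also have "\<dots> \<le> L" unfolding L_def using assms by (intro power_increasing) (auto simp: J_def)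
  finally show ?thesis using P_gt_L[OF assms(2)] by simp
qed

lemma dens_half:
  assumes "j \<in> J" "p \<in> P j"
  shows "0 \<le> real (card (R p)) / real p \<and> real (card (R p)) / real p \<le> 1 / 2"
proof -
  have "real (2 * card (R p)) \<le> real p" using two_card_R_le[OF assms] by (subst of_nat_le_iff)
  moreover have "real p > 0" using P_gt_L[OF assms(2)] by simp
  ultimately show ?thesis by (simp add: field_simps)
qed

lemma block_factor_le:
  assumes "j \<in> J"
  shows "1 + (\<Sum>p\<in>P j. card (R p)) \<le> Z j ^ 2"
proof -
  \<comment> \<open>Starting at 2 saves one prime, which makes room for the leading 1 in the
    claim.\<close>
  have "P j \<subseteq> {2..Z j}" using prime_ge_2_nat by (auto simp: P_def)
  then have "card (P j) \<le> Z j - 1" using card_mono[of "{2..Z j}" "P j"] by simp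
  moreover have "2 ^ j \<le> Z j"
  proof -
    have "(2::nat) ^ j \<le> L" unfolding L_def using assms by (intro power_increasing) (auto simp: J_def)
    then show ?thesis using Z_ge_L[of j] by linarith
  qed
  moreover have "(\<Sum>p\<in>P j. card (R p)) \<le> card (P j) * 2 ^ j"
    using card_R_le[OF assms] sum_bounded_above[of "P j" "\<lambda>p. card (R p)" "2 ^ j"] by simp
  ultimately have "(\<Sum>p\<in>P j. card (R p)) \<le> (Z j - 1) * Z j" by (meson mult_le_mono order.trans)
  moreover have "(Z j - 1) * Z j + Z j = Z j ^ 2" using Z_ge_L[of j] L_ge_2
    by (cases "Z j") (auto simp: power2_eq_square)
  ultimately show ?thesis using Z_ge_L[of j] L_ge_2 by linarith
qed

text \<open>Block \<open>j\<close> contributes 2 * 47 * 2^j * H * 4^(H-j) = 94 * H * 2^(2H-j) to the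
  exponent of 2. The geometric sum from 11 is at most 2^(2H-10), and \<open>H = 10 * h\<close>
  leaves 940 \<le> 2^10.\<close>

lemma sieve_level_le: "(\<Prod>j\<in>J. (1 + (\<Sum>p\<in>P j. card (R p))) ^ Suc (46 * 2 ^ j)) \<le> Y"
proof -
  have "(\<Prod>j\<in>J. (1 + (\<Sum>p\<in>P j. card (R p))) ^ Suc (46 * 2 ^ j)) \<le> (\<Prod>j\<in>J. 2 ^ (94 * H * 2 ^ (2 * H - j)))"
  proof (rule prod_mono, intro conjI)
    fix j assume j: "j \<in> J"
    have "(1 + (\<Sum>p\<in>P j. card (R p))) ^ Suc (46 * 2 ^ j) \<le> (Z j ^ 2) ^ Suc (46 * 2 ^ j)"
      using block_factor_le[OF j] by (intro power_mono) auto
    also have "\<dots> \<le> (Z j ^ 2) ^ (47 * 2 ^ j)" using Z_ge_L[of j] L_ge_2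
      by (intro power_increasing) auto
    also have "\<dots> = 2 ^ (94 * H * (4 ^ (H - j) * 2 ^ j))"
      unfolding Z_def by (simp add: mult_ac flip: power_mult)
    also have "4 ^ (H - j) * 2 ^ j = (2::nat) ^ (2 * H - j)"
    proof -
      have "(4::nat) ^ (H - j) * 2 ^ j = 2 ^ (2 * (H - j) + j)" by (simp add: power_add power_mult)
      also have "2 * (H - j) + j = 2 * H - j" using j by (auto simp: J_def)
      finally show ?thesis .
    qed
    finally show "(1 + (\<Sum>p\<in>P j. card (R p))) ^ Suc (46 * 2 ^ j) \<le> 2 ^ (94 * H * 2 ^ (2 * H - j))" .
  qed auto
  also have "\<dots> = 2 ^ (94 * H * (\<Sum>j\<in>J. 2 ^ (2 * H - j)))"
    by (simp add: sum_distrib_left flip: power_sum)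
  also have "\<dots> \<le> 2 ^ (h * 4 ^ H)"
  proof (rule power_increasing)
    have "(\<Sum>j\<in>J. 2 ^ (2 * H - j)) \<le> (2::nat) ^ (2 * H - 10)"
      using sum_descending_powers2[of 10 H "2 * H"] H_ge by (simp add: J_def)
    then have "94 * H * (\<Sum>j\<in>J. 2 ^ (2 * H - j)) \<le> 94 * H * 2 ^ (2 * H - 10)" by (rule mult_left_mono) simp
    also have "\<dots> = 940 * (h * 2 ^ (2 * H - 10))" by (simp add: H_def)
    also have "\<dots> \<le> 2 ^ 10 * (h * 2 ^ (2 * H - 10))" by simp
    also have "\<dots> = h * (2 ^ 10 * 2 ^ (2 * H - 10))" by simp
    also have "2 ^ 10 * 2 ^ (2 * H - 10) = (2::nat) ^ (10 + (2 * H - 10))" by (rule power_add[symmetric])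
    also have "10 + (2 * H - 10) = 2 * H" using H_ge by simp
    also have "(2::nat) ^ (2 * H) = 4 ^ H" by (simp add: power_mult)
    finally show "94 * H * (\<Sum>j\<in>J. 2 ^ (2 * H - j)) \<le> h * 4 ^ H" .
  qed simp
  finally show ?thesis by (simp only: Y_def)
qed

sublocale block_sieve J P R "\<lambda>j. 46 * 2 ^ j" "\<lambda>j. (1 / 2) ^ (j + 2)" "real Y"
proof
  show "finite J" by (simp add: J_def)
  show "finite (P j)" for j by (rule finite_P)
  show "P i \<inter> P j = {}" if "i \<noteq> j" for i j using that by (rule P_disjoint)
  show "prime p" if "p \<in> P j" for p j using that by (simp add: P_def)
  show "R p \<subseteq> {..<p}" for p by (auto simp: R_def)
  show "2 * card (R p) \<le> p" if "j \<in> J" "p \<in> P j" for p j using that by (rule two_card_R_le)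
  show "even (46 * 2 ^ j :: nat)" for j by simp
  show "0 \<le> (1 / 2 :: real) ^ (j + 2)" for j by simp
  show "sympoly (only_at (Suc (46 * 2 ^ j))) (\<lambda>p. real (card (R p)) / real p) (P j)
      \<le> (1 / 2) ^ (j + 2) * (\<Prod>p\<in>P j. 1 - real (card (R p)) / real p)" if j: "j \<in> J" for j
  proof -
    have "sympoly (only_at (Suc (46 * 2 ^ j))) (\<lambda>p. real (card (R p)) / real p) (P j)
        \<le> exp (- 4 * real (2 ^ j)) * (\<Prod>p\<in>P j. 1 - real (card (R p)) / real p)"
      by (rule sympoly_tail_le[OF finite_P dens_half[OF j] dens_sum_le[OF j]])
    also have "\<dots> \<le> (1 / 2) ^ (j + 2) * (\<Prod>p\<in>P j. 1 - real (card (R p)) / real p)"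
    proof (rule mult_right_mono[OF exp_minus_power2_le], rule prod_nonneg)
      show "0 \<le> 1 - real (card (R p)) / real p" if "p \<in> P j" for p using dens_half[OF j that] by linarith
    qed
    finally show ?thesis .
  qed
  have "(\<Sum>j\<in>J. (1 / 2 :: real) ^ (j + 2)) \<le> (\<Sum>j<H. (1 / 2) ^ (j + 2))"
    by (rule sum_mono2) (auto simp: J_def)
  then show "(\<Sum>j\<in>J. (1 / 2 :: real) ^ (j + 2)) \<le> 1 / 2" using sum_half_powers[of H] by linarith
  have "real (\<Prod>j\<in>J. (1 + (\<Sum>p\<in>P j. card (R p))) ^ Suc (46 * 2 ^ j)) \<le> real Y"
    using sieve_level_le by (subst of_nat_le_iff)
  then show "(\<Prod>j\<in>J. (1 + (\<Sum>p\<in>P j. real (card (R p)))) ^ Suc (46 * 2 ^ j)) \<le> real Y"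
    by (simp only: of_nat_prod of_nat_power of_nat_add of_nat_sum of_nat_1)
qed

text \<open>The block sums cost only exp (-16 * 2^H), while log Y has order h * 4^H. It follows that
  X * V is at least Y^9, which dwarfs all sieve remainders.\<close>

lemma V_ge: "1 \<le> real Y * V"
proof -
  have "exp (- 16 * 2 ^ H) \<le> exp (\<Sum>j\<in>J. - 2 * (8 * real (2 ^ j)))"
  proof -
    have "(\<Sum>j\<in>J. (2::nat) ^ j) \<le> (\<Sum>j<H. 2 ^ j)" by (rule sum_mono2) (auto simp: J_def)
    also have "(\<Sum>j<n. (2::nat) ^ j) \<le> 2 ^ n" for n by (induction n) auto
    finally have "real (\<Sum>j\<in>J. 2 ^ j) \<le> real (2 ^ H)" by (subst of_nat_le_iff)
    then show ?thesis by (simp add: sum_negf flip: sum_distrib_left)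
  qed
  also have "\<dots> = (\<Prod>j\<in>J. exp (- 2 * (8 * real (2 ^ j))))" by (rule exp_sum) (simp add: J_def)
  also have "\<dots> \<le> V" unfolding V_def dens_def
    using prod_one_minus_ge[OF dens_half dens_sum_le finite_P] by (intro prod_mono) auto
  finally have 1: "exp (- 16 * 2 ^ H) \<le> V" .
  have "exp (16 * 2 ^ H) = (exp 1 :: real) ^ (16 * 2 ^ H :: nat)" using exp_of_nat_mult[of "16 * 2 ^ H" "1::real"] by simp
  also have "\<dots> \<le> (4::real) ^ (16 * 2 ^ H :: nat)" using exp_le by (intro power_mono) auto
  also have "\<dots> = (2::real) ^ (2 * (16 * 2 ^ H) :: nat)" by (simp only: power_mult) simp
  also have "\<dots> \<le> 2 ^ (h * 4 ^ H)"
  proof (rule power_increasing)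
    have "(2::nat) ^ 5 * 2 ^ H \<le> 2 ^ H * 2 ^ H"
      using H_ge by (intro mult_right_mono power_increasing) auto
    also have "\<dots> = 1 * 4 ^ H" by (simp flip: power_mult_distrib)
    also have "\<dots> \<le> h * 4 ^ H" using h_ge_2 by (intro mult_right_mono) auto
    finally show "2 * (16 * 2 ^ H) \<le> h * 4 ^ H" by simp
  qed simp
  finally have "exp (16 * 2 ^ H) \<le> real Y" by (simp add: Y_def)
  then have "exp (16 * 2 ^ H) * exp (- 16 * 2 ^ H) \<le> real Y * V" using 1 V_pos by (intro mult_mono) auto
  then show ?thesis by (simp add: exp_minus)
qed

text \<open>Ensures \<open>W * m \<le> Y ^ 20\<close> for \<open>m \<le> X\<close>, which makes
  \<open>k > Y\<close> trivial.\<close>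

lemma W_le: "W \<le> Y ^ 10"
proof -
  have "fact L \<le> L ^ L" using fact_le_power[of L, where ?'a=nat] by simp
  then have "W \<le> (L ^ L) ^ 2" unfolding W_def by (intro power_mono) auto
  also have "\<dots> = 2 ^ (H * (2 * L))" unfolding L_def by (simp add: mult_ac flip: power_mult)
  also have "\<dots> \<le> 2 ^ (H * 4 ^ H)"
  proof (intro power_increasing mult_le_mono order.refl)
    have "2 * L \<le> L * L" using L_ge_2 by (intro mult_right_mono) auto
    also have "\<dots> = 4 ^ H" by (simp add: L_def flip: power_mult_distrib)
    finally show "2 * L \<le> 4 ^ H" .
  qed simp
  also have "\<dots> = Y ^ 10" unfolding Y_def H_def by (simp add: mult_ac flip: power_mult)
  finally show ?thesis .
qed

lemma L_le_Y: "L \<le> Y"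
  unfolding L_def Y_def
proof (rule power_increasing)
  have "H \<le> 2 ^ H" by (simp add: less_imp_le)
  also have "(2::nat) ^ H \<le> 4 ^ H" by (rule power_mono) auto
  also have "\<dots> \<le> h * 4 ^ H" using h_ge_2 by simp
  finally show "H \<le> h * 4 ^ H" .
qed simp

lemma H_less_Y: "H < Y"
  using L_le_Y less_exp[of H] unfolding L_def by linarith

lemma Y_ge_64: "64 \<le> Y"
proof -
  have "(2::nat) ^ 6 \<le> L" unfolding L_def using H_ge by (intro power_increasing) auto
  then show ?thesis using L_le_Y by simp
qed

end

section \<open>Survivors with many prime factors\<close>

text \<open>64^(-level) \<le> k^(-6) \<le> 1 / (16 k^2) for \<open>k \<ge> 2\<close>, and the sum of
  1 / k^2 is majorized by a telescoping sum.\<close>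

lemma sum_inverse_level_le: "(\<Sum>k\<in>{2..n}. (1 / 64 :: real) ^ dyadic_level k) \<le> 1 / 16"
proof -
  have "(1 / 64 :: real) ^ dyadic_level k \<le> 1 / 16 * (1 / real (k - 1) - 1 / real k)" if k: "2 \<le> k" for k
  proof -
    have rk: "real k \<ge> 2" using k by simp
    have "real k \<le> real (2 ^ dyadic_level k)" using le_power_level by (subst of_nat_le_iff)
    then have "real k ^ 6 \<le> (2 ^ dyadic_level k) ^ 6" by (intro power_mono) auto
    also have "\<dots> = (2 ^ 6) ^ dyadic_level k" by (metis power_mult mult.commute)
    finally have "real k ^ 6 \<le> 64 ^ dyadic_level k" by simp
    then have "(1 / 64 :: real) ^ dyadic_level k \<le> 1 / real k ^ 6" using rk by (simp add: power_one_over frac_le)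
    also have "\<dots> \<le> 1 / (16 * real k ^ 2)"
    proof -
      have "(2::real) ^ 4 \<le> real k ^ 4" using rk by (intro power_mono) auto
      then have "16 * real k ^ 2 \<le> real k ^ 4 * real k ^ 2" by (intro mult_right_mono) auto
      also have "\<dots> = real k ^ 6" by (simp flip: power_add)
      finally show ?thesis using rk by (intro divide_left_mono) auto
    qed
    also have "\<dots> \<le> 1 / (16 * (real k * (real k - 1)))"
      using rk by (intro divide_left_mono) (auto simp: power2_eq_square)
    also have "\<dots> = 1 / 16 * (1 / real (k - 1) - 1 / real k)" using rk k by (simp add: of_nat_diff field_simps)
    finally show ?thesis .
  qed
  then have "(\<Sum>k\<in>{2..n}. (1 / 64 :: real) ^ dyadic_level k) \<le> (\<Sum>k\<in>{2..n}. 1 / 16 * (1 / real (k - 1) - 1 / real k))"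
    by (intro sum_mono) auto
  also have "\<dots> = 1 / 16 * (\<Sum>k\<in>{2..n}. 1 / real (k - 1) - 1 / real k)" by (rule sum_distrib_left[symmetric])
  also have "(\<Sum>k\<in>{2..n}. 1 / real (k - 1) - 1 / real k) \<le> 1"
  proof (cases "n \<ge> 1")
    case True
    then have "(\<Sum>k\<in>{2..n}. 1 / real (k - 1) - 1 / real k) = 1 - 1 / real n"
    proof (induction n rule: dec_induct)
      case base
      then show ?case by simp
    next
      case (step n)
      then show ?case by simp
    qed
    then show ?thesis by simp
  qed simp
  finally show ?thesis by simp
qed

context scales
begin

text \<open>For \<open>2 ^ (i - 1) < k \<le> 2 ^ i\<close> these are the primes that the sieve does not exclude from \<open>n - k\<close> but
  that are so small that \<open>n - k\<close> may contain more than \<open>O(i)\<close> of them.\<close>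

definition mid_primes :: "nat \<Rightarrow> nat set" where
  "mid_primes i = {p. prime p \<and> p ^ (depth * i) \<le> Y \<and> (i \<le> H \<longrightarrow> Z (max i 11) < p)}"

lemma mid_primes_le:
  assumes "i > 0" "p \<in> mid_primes i"
  shows "p \<le> Y"
proof -
  have "p \<ge> 1" using assms prime_ge_1_nat by (auto simp: mid_primes_def)
  then have "p \<le> p ^ (depth * i)" using assms depth_pos by (intro self_le_power) auto
  then show ?thesis using assms by (auto simp: mid_primes_def)
qed

lemma finite_mid_primes: "i > 0 \<Longrightarrow> finite (mid_primes i)"
  by (rule finite_subset[of _ "{..Y}"]) (auto dest: mid_primes_le)

lemma Y_le_X: "Y \<le> X"
  unfolding X_def using Y_pos by (intro self_le_power) auto

lemma finite_primes_between: "finite {p::nat. prime p \<and> a < p \<and> p \<le> b}"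
  by (rule finite_subset[of _ "{..b}"]) auto

lemma sum_inverse_above_Z:
  assumes "j \<le> H"
  shows "(\<Sum>p | prime p \<and> Z j < p \<and> p \<le> X. 1 / real p) \<le> 8 * real j"
  using assms
proof (induction j)
  case 0
  have "{p. prime p \<and> Z 0 < p \<and> p \<le> X} = {}" by (auto simp: X_eq_Z0)
  then show ?case by (simp only:) simp
next
  case (Suc j)
  let ?A = "{p. prime p \<and> Z j < p \<and> p \<le> X}"
  have "{p. prime p \<and> Z (Suc j) < p \<and> p \<le> X} = ?A \<union> P j"
    using Z_antimono[of j "Suc j"] Z_antimono[of 0 j] by (auto simp: P_def X_eq_Z0)
  moreover have "?A \<inter> P j = {}" by (auto simp: P_def)
  ultimately have "(\<Sum>p | prime p \<and> Z (Suc j) < p \<and> p \<le> X. 1 / real p) = (\<Sum>p\<in>?A. 1 / real p) + (\<Sum>p\<in>P j. 1 / real p)"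
    using finite_P finite_primes_between by (simp only:) (rule sum.union_disjoint)
  also have "\<dots> \<le> 8 * real j + 8" using Suc sum_inverse_P_le[of j] by (intro add_mono) auto
  finally show ?case by simp
qed

lemma sum_inverse_mid_primes:
  assumes "i > 0"
  shows "(\<Sum>p\<in>mid_primes i. 1 / real p) \<le> 99 * real i"
proof (cases "i \<le> H")
  case True
  have "mid_primes i \<subseteq> {p. prime p \<and> Z (max i 11) < p \<and> p \<le> X}"
    using True mid_primes_le[OF assms] Y_le_X by (auto simp: mid_primes_def intro: order.trans)
  then have "(\<Sum>p\<in>mid_primes i. 1 / real p) \<le> (\<Sum>p | prime p \<and> Z (max i 11) < p \<and> p \<le> X. 1 / real p)"
    using finite_primes_between by (intro sum_mono2) auto
  also have "\<dots> \<le> 8 * real (max i 11)" using True H_ge by (intro sum_inverse_above_Z) auto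
  also have "\<dots> \<le> 99 * real i" using assms by auto
  finally show ?thesis .
next
  case False
  let ?A = "{p. prime p \<and> Z H < p \<and> p \<le> X}"
  have "mid_primes i \<subseteq> {2..2 ^ H} \<union> ?A"
  proof
    fix p assume p: "p \<in> mid_primes i"
    then have "prime p" "p \<le> X" using mid_primes_le[OF assms p] Y_le_X by (auto simp: mid_primes_def)
    moreover have "2 \<le> p" using \<open>prime p\<close> by (rule prime_ge_2_nat)
    ultimately show "p \<in> {2..2 ^ H} \<union> ?A" by (cases "p \<le> 2 ^ H") (simp_all add: Z_H L_def)
  qed
  then have "(\<Sum>p\<in>mid_primes i. 1 / real p) \<le> (\<Sum>p\<in>{2..2 ^ H} \<union> ?A. 1 / real p)"
    using finite_primes_between by (intro sum_mono2) auto
  also have "\<dots> = (\<Sum>p\<in>{2..2 ^ H}. 1 / real p) + (\<Sum>p\<in>?A. 1 / real p)"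
    using finite_primes_between by (intro sum.union_disjoint) (auto simp: Z_H L_def)
  also have "\<dots> \<le> real H + 8 * real H"
    by (intro add_mono sum_inverse_upto_power2 sum_inverse_above_Z) auto
  also have "\<dots> \<le> 99 * real i" using False by simp
  finally show ?thesis .
qed

abbreviation divisors_at :: "nat \<Rightarrow> nat set" where
  "divisors_at i \<equiv> Omega_level (mid_primes i) (depth * i)"

lemma finite_divisors_at: "i > 0 \<Longrightarrow> finite (divisors_at i)"
  by (rule finite_Omega_level[OF finite_mid_primes]) (auto simp: mid_primes_def)

lemma sum_divisors_at_le:
  assumes "i > 0"
  shows "(\<Sum>e\<in>divisors_at i. 2 ^ card (prime_factors e) / real e) \<le> (1 / 64) ^ i"
proof -
  have "(\<Sum>e\<in>divisors_at i. 2 ^ card (prime_factors e) / real e)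
      \<le> (2 / 3) ^ (depth * i) * exp (12 * (\<Sum>p\<in>mid_primes i. 1 / real p))"
    by (rule sum_Omega_level_le[OF finite_mid_primes[OF assms]]) (simp add: mid_primes_def)
  also have "\<dots> \<le> (2 / 3) ^ (depth * i) * exp (real i * 1188)"
    using sum_inverse_mid_primes[OF assms] by (intro mult_left_mono) auto
  also have "\<dots> = ((2 / 3) ^ depth * exp 1188) ^ i"
    by (simp only: exp_of_nat_mult power_mult power_mult_distrib)
  also have "\<dots> \<le> (1 / 64) ^ i" by (rule power_mono[OF depth_decay]) simp
  finally show ?thesis .
qed

text \<open>Such an \<open>e\<close> has exactly \<open>depth * i\<close> prime factors, each at
  most Y^(1/(depth * i)); the size limit in \<open>mid_primes\<close> was chosen for this.\<close>

lemma divisors_at_le: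
  assumes "i > 0" "e \<in> divisors_at i"
  shows "0 < e" "e \<le> Y"
proof -
  show e: "0 < e" using assms by (simp add: Omega_level_def)
  have "prod_mset (prime_factorization e) ^ (depth * i) \<le> Y ^ size (prime_factorization e)"
    using assms by (intro prod_mset_power_le) (auto simp: Omega_level_def mid_primes_def)
  then have "e ^ (depth * i) \<le> Y ^ (depth * i)"
    using assms e by (simp add: Omega_level_def Omega_def prod_mset_prime_factorization)
  moreover have "depth * i > 0" using assms depth_pos by simp
  ultimately show "e \<le> Y" using power_mono_iff[of e Y "depth * i"] by simp
qed

text \<open>\<open>n - k\<close> with the common factor of \<open>W\<close> and \<open>k\<close>
  removed. The primes of \<open>e\<close> may divide \<open>W\<close> when \<open>i > H\<close>;
  after the division the coefficients are coprime, so \<open>e\<close> dividing the cofactor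
  confines \<open>m\<close> to one class. The removed factor is at most \<open>k\<close> and has at
  most log 2 k prime factors.\<close>

definition cofactor :: "nat \<Rightarrow> nat \<Rightarrow> nat" where
  "cofactor k m = W div gcd W k * m - k div gcd W k"

lemma W_pos: "W > 0" by (simp add: W_def)

lemma gcd_cofactor:
  shows "gcd W k * cofactor k m = W * m - k"
    and "k < W * m \<longleftrightarrow> k div gcd W k < W div gcd W k * m"
proof -
  have *: "gcd W k * (W div gcd W k * m) = W * m" "gcd W k * (k div gcd W k) = k"
    by (simp_all flip: mult.assoc)
  show "gcd W k * cofactor k m = W * m - k"
    unfolding cofactor_def diff_mult_distrib2 * ..
  have "gcd W k > 0" using W_pos by simp
  then show "k < W * m \<longleftrightarrow> k div gcd W k < W div gcd W k * m"
    using * by (metis nat_mult_less_cancel1)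
qed

lemma card_sifted_dvd_le:
  assumes "e > 0"
  shows "real (card {m \<in> {1..X}. sifted m \<and> k < W * m \<and> e dvd cofactor k m})
    \<le> 2 * real X * V * (2 ^ card (prime_factors e) / real e) + real Y"
proof -
  have "coprime (W div gcd W k) (k div gcd W k)" using W_pos by (intro div_gcd_coprime) auto
  then obtain a where a: "\<And>m. k div gcd W k < W div gcd W k * m \<Longrightarrow>
      e dvd W div gcd W k * m - k div gcd W k \<Longrightarrow> m mod e = a mod e"
    using linear_residue_class by metis
  have "card {m \<in> {1..X}. sifted m \<and> k < W * m \<and> e dvd cofactor k m}
      \<le> card {m \<in> {1..X}. m mod e = a mod e \<and> sifted m}"
    using a by (intro card_mono) (auto simp: gcd_cofactor(2) cofactor_def)
  then have "real (card {m \<in> {1..X}. sifted m \<and> k < W * m \<and> e dvd cofactor k m})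
      \<le> real (card {m \<in> {1..X}. m mod e = a mod e \<and> sifted m})" by (subst of_nat_le_iff)
  also have "\<dots> \<le> 2 * real X * V * (2 ^ card (prime_factors e) / real e) + real Y"
    by (rule card_sifted_residue_class_le[OF assms])
  finally show ?thesis .
qed

text \<open>The union bound gives at most X * V / 8 + Y^3 bad survivors, the remainders coming from
  at most \<open>Y\<close> values of \<open>k\<close>, \<open>Y\<close> divisors each and
  \<open>Y\<close> per divisor. There are at least X * V / 2 - Y^2 survivors, and X * V is at least
  Y^9.\<close>

lemma ex_good:
  "\<exists>m\<in>{1..X}. sifted m \<and> (\<forall>k\<in>{2..Y}. \<forall>e\<in>divisors_at (dyadic_level k). \<not> (k < W * m \<and> e dvd cofactor k m))"
proof (rule ccontr)
  assume neg: "\<not> ?thesis"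
  define bad where "bad k e = {m \<in> {1..X}. sifted m \<and> k < W * m \<and> e dvd cofactor k m}" for k e
  have finD: "finite (divisors_at (dyadic_level k))" if "k \<in> {2..Y}" for k
    using that dyadic_level_pos by (intro finite_divisors_at) auto
  have "{m \<in> {1..X}. sifted m} \<subseteq> (\<Union>k\<in>{2..Y}. \<Union>e\<in>divisors_at (dyadic_level k). bad k e)"
    using neg unfolding bad_def by blast
  then have "card {m \<in> {1..X}. sifted m} \<le> card (\<Union>k\<in>{2..Y}. \<Union>e\<in>divisors_at (dyadic_level k). bad k e)"
    using finD by (intro card_mono) (auto simp: bad_def)
  also have "\<dots> \<le> (\<Sum>k\<in>{2..Y}. card (\<Union>e\<in>divisors_at (dyadic_level k). bad k e))" by (rule card_UN_le) simp
  also have "\<dots> \<le> (\<Sum>k\<in>{2..Y}. \<Sum>e\<in>divisors_at (dyadic_level k). card (bad k e))"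
    using finD by (intro sum_mono card_UN_le)
  finally have "real (card {m \<in> {1..X}. sifted m}) \<le> real (\<Sum>k\<in>{2..Y}. \<Sum>e\<in>divisors_at (dyadic_level k). card (bad k e))"
    by (subst of_nat_le_iff)
  also have "\<dots> = (\<Sum>k\<in>{2..Y}. \<Sum>e\<in>divisors_at (dyadic_level k). real (card (bad k e)))" by simp
  also have "\<dots> \<le> (\<Sum>k\<in>{2..Y}. 2 * real X * V * (1 / 64) ^ dyadic_level k + real Y * real Y)"
  proof (rule sum_mono)
    fix k assume k: "k \<in> {2..Y}"
    then have i: "dyadic_level k > 0" using dyadic_level_pos by simp
    have "divisors_at (dyadic_level k) \<subseteq> {1..Y}" using divisors_at_le[OF i] by force
    then have cD: "real (card (divisors_at (dyadic_level k))) \<le> real Y"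
      using card_mono[of "{1..Y}" "divisors_at (dyadic_level k)"] by simp
    have "(\<Sum>e\<in>divisors_at (dyadic_level k). real (card (bad k e)))
        \<le> (\<Sum>e\<in>divisors_at (dyadic_level k). 2 * real X * V * (2 ^ card (prime_factors e) / real e) + real Y)"
      unfolding bad_def using divisors_at_le[OF i] by (intro sum_mono card_sifted_dvd_le) auto
    also have "\<dots> = 2 * real X * V * (\<Sum>e\<in>divisors_at (dyadic_level k). 2 ^ card (prime_factors e) / real e)
        + real (card (divisors_at (dyadic_level k))) * real Y"
      by (simp add: sum.distrib sum_distrib_left)
    also have "\<dots> \<le> 2 * real X * V * (1 / 64) ^ dyadic_level k + real Y * real Y"
      using sum_divisors_at_le[OF i] cD V_pos by (intro add_mono mult_left_mono mult_right_mono) auto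
    finally show "(\<Sum>e\<in>divisors_at (dyadic_level k). real (card (bad k e)))
        \<le> 2 * real X * V * (1 / 64) ^ dyadic_level k + real Y * real Y" .
  qed
  also have "\<dots> = 2 * real X * V * (\<Sum>k\<in>{2..Y}. (1 / 64) ^ dyadic_level k) + real (card {2..Y}) * (real Y * real Y)"
    by (simp add: sum.distrib sum_distrib_left)
  also have "\<dots> \<le> 2 * real X * V * (1 / 16) + real Y * (real Y * real Y)"
    using sum_inverse_level_le[of Y] V_pos by (intro add_mono mult_left_mono mult_right_mono) auto
  finally have upper: "real (card {m \<in> {1..X}. sifted m}) \<le> real X * V / 8 + real Y ^ 3"
    by (simp add: power3_eq_cube)
  have "1 + card J \<le> Y" using H_less_Y by (simp add: J_def)
  then have "real (1 + card J) \<le> real Y" by (subst of_nat_le_iff)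
  then have "(1 + real (card J)) * real Y \<le> real Y * real Y" by (intro mult_right_mono) auto
  then have lower: "real X * V * (1 / 2) - real Y ^ 2 \<le> real (card {m \<in> {1..X}. sifted m})"
    using card_sifted_ge[of X] by (simp add: power2_eq_square)
  have y: "real Y \<ge> 64" using Y_ge_64 by simp
  have "real Y ^ 9 * 1 \<le> real Y ^ 9 * (real Y * V)" using V_ge by (intro mult_left_mono) auto
  also have "\<dots> = real Y ^ Suc 9 * V" by (simp only: power_Suc mult_ac)
  also have "\<dots> = real X * V" by (simp add: X_def)
  finally have "real Y ^ 9 \<le> real X * V" by simp
  moreover have "64 * real Y ^ 3 \<le> real Y ^ 9"
  proof -
    have "64 * real Y ^ 3 \<le> real Y ^ 6 * real Y ^ 3"
      using order.trans[OF y self_le_power[of "real Y" 6]] y by (intro mult_right_mono) auto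
    then show ?thesis by (simp flip: power_add)
  qed
  moreover have "real Y ^ 2 \<le> real Y ^ 3" using y by (intro power_increasing) auto
  moreover have "real Y ^ 3 > 0" using y by simp
  ultimately show False using upper lower by linarith
qed

section \<open>From a good survivor to the bound on \<open>Omega\<close>\<close>

lemma W_ge: "W \<ge> h"
proof -
  have "h \<le> H" by (simp add: H_def)
  also have "H \<le> L" by (simp add: L_def less_imp_le)
  also have "L \<le> fact L" by (rule fact_ge_self)
  also have "\<dots> \<le> W" unfolding W_def by (intro self_le_power) auto
  finally show ?thesis .
qed

text \<open>A prime up to \<open>L\<close> would divide both a positive multiple of
  \<open>fact L\<close> and its predecessor. A larger one lies in a block \<open>j\<close> with
  \<open>k \<le> 2 ^ j\<close>, so \<open>m\<close> would fall in a class excluded by the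
  sieve.\<close>

lemma sifted_prime_factor_large:
  assumes m: "sifted m" and k: "2 \<le> k" "k < W * m" and p: "prime p" "p dvd cofactor k m"
    and i: "dyadic_level k \<le> H"
  shows "Z (max (dyadic_level k) 11) < p"
proof (rule ccontr)
  assume "\<not> Z (max (dyadic_level k) 11) < p"
  then have pZ: "p \<le> Z (max (dyadic_level k) 11)" by simp
  have dvd: "p dvd W * m - k" using p(2) gcd_cofactor(1)[of k m] by (metis dvd_mult)
  have "k \<le> 2 ^ dyadic_level k" by (rule le_power_level)
  also have "\<dots> \<le> L" unfolding L_def using i by (intro power_increasing) auto
  finally have kL: "k \<le> L" .
  show False
  proof (cases "p \<le> L")
    case True
    \<comment> \<open>This is why \<open>W\<close> is a square: one factor \<open>fact L\<close>
      absorbs \<open>k\<close>, the other keeps \<open>p\<close> a divisor of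
      \<open>W div k\<close>.\<close>
    have kf: "k dvd fact L" using k kL by (intro dvd_fact) auto
    then have "gcd W k = k" unfolding W_def by (simp add: gcd_nat.absorb2 dvd_power_le[of k "fact L" 1 2, simplified] power2_eq_square)
    moreover have "W div k = fact L * (fact L div k)"
      using kf by (simp add: W_def power2_eq_square div_mult_swap)
    ultimately have "cofactor k m = fact L * (fact L div k) * m - 1" using k by (simp add: cofactor_def)
    moreover have "p dvd fact L * (fact L div k) * m"
      using True p(1) prime_ge_1_nat by (intro dvd_mult2 dvd_fact) auto
    moreover have "fact L * (fact L div k) * m \<noteq> 0"
      using gcd_cofactor(2)[of k m] k \<open>gcd W k = k\<close> \<open>W div k = _\<close> by (metis less_nat_zero_code)
    then have "1 \<le> fact L * (fact L div k) * m" by linarith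
    ultimately have "p dvd 1" using p(2) by (metis dvd_diffD1)
    then show False using p(1) by simp
  next
    case False
    then have "Z H < p" by (simp add: Z_H)
    then obtain j where j: "max (dyadic_level k) 11 \<le> j" "j < H" "Z (Suc j) < p" "p \<le> Z j"
      using ex_between_antimono[of Z H p "max (dyadic_level k) 11"] pZ i H_ge by auto
    then have pj: "j \<in> J" "p \<in> P j" using p by (auto simp: J_def P_def)
    have "k \<le> 2 ^ j" 
      using order.trans[OF le_power_level[of k] power_increasing[of "dyadic_level k" j "2::nat"]] j(1) by simp
    moreover have "[W * (m mod p) = k] (mod p)"
    proof -
      have "[W * m = k] (mod p)" using dvd k by (simp add: cong_altdef_nat)
      then show ?thesis by (simp add: cong_def mod_mult_right_eq)
    qed
    moreover have "m mod p < p" using p(1) prime_gt_0_nat by simp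
    moreover have "k \<in> {2..2 ^ j}" using k \<open>k \<le> 2 ^ j\<close> by simp
    ultimately have "m mod p \<in> R p" unfolding R_def using pj by blast
    then show False using m pj unfolding sifted_def by blast
  qed
qed

text \<open>For \<open>k \<le> Y\<close> and \<open>i\<close> the level of \<open>k\<close>, at most
  \<open>20 * depth * i\<close> prime factors of the cofactor lie outside
  \<open>mid_primes i\<close> and fewer than \<open>depth * i\<close> inside. Since i \<le> 2 * log
  2 k this gives 42 * depth, and the gcd adds 1. For \<open>k > Y\<close> the size of
  \<open>n\<close> already gives 20.\<close>

lemma Omega_bound:
  assumes m: "m \<in> {1..X}" "sifted m"
    and good: "\<And>k e. k \<in> {2..Y} \<Longrightarrow> e \<in> divisors_at (dyadic_level k) \<Longrightarrow> k < W * m \<Longrightarrow> \<not> e dvd cofactor k m"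
    and k: "1 < k" "k < W * m"
  shows "real (Omega (W * m - k)) \<le> real (42 * depth + 1) * log 2 (real k)"
proof -
  have logk: "log 2 (real k) \<ge> 0" using k by simp
  have n: "W * m \<le> Y ^ 20"
  proof -
    have "W * m \<le> Y ^ 10 * Y ^ 10" using W_le m by (intro mult_le_mono) (auto simp: X_def)
    then show ?thesis by (simp flip: power_add)
  qed
  show ?thesis
  proof (cases "k \<le> Y")
    case False
    have "real (Omega (W * m - k)) \<le> log 2 (real (W * m - k))" using k by (intro Omega_le_log) auto
    also have "\<dots> \<le> log 2 (real k ^ 20)"
    proof -
      have "W * m - k \<le> Y ^ 20" using n by simp
      also have "\<dots> \<le> k ^ 20" using False by (intro power_mono) auto
      finally have "real (W * m - k) \<le> real (k ^ 20)" by (subst of_nat_le_iff)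
      also have "\<dots> = real k ^ 20" by simp
      finally have le: "real (W * m - k) \<le> real k ^ 20" .
      have "real (W * m - k) > 0" using k by (simp only: of_nat_0_less_iff zero_less_diff)
      then show ?thesis using le by (rule log_mono[of 2, rotated]) simp
    qed
    also have "\<dots> = 20 * log 2 (real k)" using k by (simp add: log_nat_power)
    also have "\<dots> \<le> real (42 * depth + 1) * log 2 (real k)"
      using logk depth_pos by (intro mult_right_mono) auto
    finally show ?thesis .
  next
    case True
    define i where "i = dyadic_level k"
    define Q where "Q = cofactor k m"
    have i: "i > 0" using k dyadic_level_pos by (simp add: i_def)
    have gQ: "gcd W k * Q = W * m - k" unfolding Q_def by (rule gcd_cofactor)
    have g: "gcd W k > 0" "gcd W k \<le> k" using W_pos k by (auto intro: gcd_le2_nat)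
    have Q: "Q > 0" using gQ k by (metis gr0I mult_0_right zero_less_diff less_irrefl)
    have QY: "Q \<le> Y ^ 20"
    proof -
      have "1 * Q \<le> gcd W k * Q" using g(1) by (intro mult_right_mono) linarith+
      then show ?thesis using gQ n by simp
    qed
    define M where "M = filter_mset (\<lambda>p. p \<notin> mid_primes i) (prime_factorization Q)"
    \<comment> \<open>A prime outside \<open>mid_primes i\<close> could also be too small, but the
      sieve and the shape of \<open>W\<close> rule that out.\<close>
    have big: "Y \<le> p ^ (depth * i)" if "p \<in># M" for p
    proof (rule ccontr)
      assume "\<not> Y \<le> p ^ (depth * i)"
      moreover have p: "prime p" "p dvd Q" "p \<notin> mid_primes i"
        using that by (auto simp: M_def dest: in_prime_factors_imp_prime in_prime_factors_imp_dvd)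
      ultimately have "i \<le> H" "\<not> Z (max i 11) < p" by (auto simp: mid_primes_def)
      then show False using sifted_prime_factor_large[OF m(2) _ k(2), of p] p k unfolding i_def Q_def by simp
    qed
    have "size M \<le> 20 * (depth * i)"
    proof -
      have "Y ^ size M \<le> prod_mset M ^ (depth * i)" by (rule prod_mset_power_ge) (rule big)
      also have "prod_mset M dvd prod_mset (prime_factorization Q)"
        unfolding M_def by (intro prod_mset_subset_imp_dvd multiset_filter_subset)
      then have "prod_mset M \<le> Q" using Q by (intro dvd_imp_le) (auto simp: prod_mset_prime_factorization)
      then have "prod_mset M ^ (depth * i) \<le> Q ^ (depth * i)" by (intro power_mono) auto
      also have "\<dots> \<le> (Y ^ 20) ^ (depth * i)" using QY by (intro power_mono) auto
      also have "\<dots> = Y ^ (20 * (depth * i))" by (rule power_mult[symmetric])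
      finally show ?thesis using Y_ge_64 by (subst (asm) power_increasing_iff) auto
    qed
    then have "Omega Q < 20 * (depth * i) + depth * i"
      using ex_Omega_level_dvd[of Q "mid_primes i" "20 * (depth * i)" "depth * i"] Q good[of k] True k
      unfolding M_def i_def Q_def by (force simp: not_less)
    then have "real (Omega Q) \<le> real (21 * depth * i)" by (subst of_nat_le_iff) simp
    also have "\<dots> = 21 * real depth * real i" by simp
    also have "\<dots> \<le> 21 * real depth * (2 * log 2 (real k))"
      unfolding i_def using k by (intro mult_left_mono dyadic_level_le_log) auto
    finally have "real (Omega Q) \<le> 42 * real depth * log 2 (real k)" by simp
    moreover have "real (Omega (gcd W k)) \<le> log 2 (real k)"
    proof -
      have "real (Omega (gcd W k)) \<le> log 2 (real (gcd W k))" using g by (intro Omega_le_log)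
      also have "0 < real (gcd W k)" "real (gcd W k) \<le> real k"
        using g by (simp_all only: of_nat_0_less_iff of_nat_le_iff)
      then have "log 2 (real (gcd W k)) \<le> log 2 (real k)" by (rule log_mono[of 2, rotated]) simp
      finally show ?thesis .
    qed
    moreover have "Omega (W * m - k) = Omega (gcd W k) + Omega Q"
      using Omega_mult[OF g(1) Q] gQ by simp
    ultimately show ?thesis by (simp add: algebra_simps)
  qed
qed

lemma ex_n:
  "\<exists>n\<ge>h. \<forall>k. 1 < k \<and> k < n \<longrightarrow> real (Omega (n - k)) \<le> real (42 * depth + 1) * log 2 (real k)"
proof -
  obtain m where m: "m \<in> {1..X}" "sifted m"
      "\<forall>k\<in>{2..Y}. \<forall>e\<in>divisors_at (dyadic_level k). \<not> (k < W * m \<and> e dvd cofactor k m)"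
    using ex_good by blast
  have "h * 1 \<le> W * m" using W_ge m by (intro mult_le_mono) auto
  then have "h \<le> W * m" by simp
  moreover have "\<forall>k. 1 < k \<and> k < W * m \<longrightarrow> real (Omega (W * m - k)) \<le> real (42 * depth + 1) * log 2 (real k)"
    using Omega_bound[OF m(1,2)] m(3) by blast
  ultimately show ?thesis by blast
qed

end

theorem theorem2:
  "\<exists>C::real. C > 0 \<and>
     infinite {n::nat. n > 0 \<and>
       (\<forall>k::nat. 1 < k \<and> k < n \<longrightarrow>
          omega (n - k) \<le> Omega (n - k) \<and> real (Omega (n - k)) \<le> C * ln (real k))}"
proof (intro exI[of _ "real (42 * depth + 1) / ln 2"] conjI)
  show "real (42 * depth + 1) / ln 2 > 0" by simp
  show "infinite {n::nat. n > 0 \<and> (\<forall>k::nat. 1 < k \<and> k < n \<longrightarrow>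
      omega (n - k) \<le> Omega (n - k) \<and> real (Omega (n - k)) \<le> real (42 * depth + 1) / ln 2 * ln (real k))}"
    unfolding infinite_nat_iff_unbounded
  proof
    fix a :: nat
    \<comment> \<open>The shift by 2 meets the requirement of the locale and yields
      \<open>n > a\<close>.\<close>
    interpret scales "a + 2" by unfold_locales simp
    obtain n where n: "n \<ge> a + 2"
        "\<forall>k. 1 < k \<and> k < n \<longrightarrow> real (Omega (n - k)) \<le> real (42 * depth + 1) * log 2 (real k)"
      using ex_n by blast
    then show "\<exists>n>a. n \<in> {n::nat. n > 0 \<and> (\<forall>k::nat. 1 < k \<and> k < n \<longrightarrow>
        omega (n - k) \<le> Omega (n - k) \<and> real (Omega (n - k)) \<le> real (42 * depth + 1) / ln 2 * ln (real k))}"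
      by (intro exI[of _ n]) (auto simp: omega_le_Omega log_def)
  qed
qed

end
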